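(* Let $a,b,c$ be positive integers with $a\le b$. Then $$L^*(H_1(a,b,c))=\frac{1}{2^a}\prod_{i=1}^a\left[\prod_{j=1}^{b-a}\frac{c+i+j-1}{i+j-1}\prod_{j=b-a+i}^{b}\frac{2c+i+j-1}{i+j-1}\right].$$
   Context: Triangular lattice: let $e=(1,0)$, $f=(1/2,\sqrt3/2)$, $g=f-e=(-1/2,\sqrt3/2)$, and consider the lattice $\mathbb Z e+\mathbb Z f$ with its tiling of the plane by unit equilateral triangles. A lozenge is the union of two unit triangles sharing an edge. A lozenge tiling of a region $R$ (a finite union of unit triangles) is a decomposition of $R$ into lozenges with disjoint interiors. $H(a,b,c)$ ($a,b,c$ positive integers) is the hexagon with vertices, in counterclockwise order, $0$ (southwestern corner), $be$ (southeastern corner), $be+af$ (eastern corner), $be+af+cg$ (northeastern corner), $af+cg$ (northwestern corner), $cg$ (western corner). Thus its horizontal sides have length $b$, the southeastern and northwestern sides have length $a$, and the northeastern and southwestern sides have length $c$. Maximal staircase at a corner $V$: let $p,q$ be the lengths of the two sides meeting at $V$, let $s,t$ be the unit vectors pointing from $V$ along these two sides (they form an angle of $120^\circ$), and let $m=\min(p,q)$. For $i,j\ge1$ let the cell $(i,j)$ be the lozenge with vertices $V+(i-1)s+(j-1)t$, $V+is+(j-1)t$, $V+is+jt$, $V+(i-1)s+jt$. The maximal staircase at $V$ is the union of all cells $(i,j)$ with $i,j\ge1$ and $i+j\le m$. The marked positions along the cut at $V$ are the $m$ cells $(i,j)$ with $i,j\ge1$ and $i+j=m+1$ (the lozenge positions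 fitting in the indentations of the zig-zag cut that removed the staircase). $H_1(a,b,c)$ is the region obtained from $H(a,b,c)$ by removing only the maximal staircase at the northwestern corner (where sides of lengths $a$ and $b$ meet). $L^*(H_1(a,b,c))=\sum_T 2^{-k(T)}$, where $T$ ranges over all lozenge tilings of $H_1(a,b,c)$ and $k(T)$ is the number of lozenges of $T$ that occupy marked positions along the cut at the northwestern corner. Empty products equal $1$. *)

theory Defs
  imports "HOL-Analysis.Analysis"
begin

definition e_vec :: "real \<times> real" where "e_vec = (1, 0)"
definition f_vec :: "real \<times> real" where "f_vec = (1 / 2, sqrt 3 / 2)"
definition g_vec :: "real \<times> real" where "g_vec = f_vec - e_vec"

definition tri_lattice :: "(real \<times> real) set" where
  "tri_lattice = {real_of_int x *\<^sub>R e_vec + real_of_int y *\<^sub>R f_vec | x y. True}"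

text \<open>The two alternatives are the triangle with a horizontal bottom side and the one with a
  horizontal top side, each described from its lowest (leftmost) vertex.\<close>
definition unit_triangle :: "(real \<times> real) set \<Rightarrow> bool" where
  "unit_triangle T \<longleftrightarrow> (\<exists>P\<in>tri_lattice.
     T = convex hull {P, P + e_vec, P + f_vec} \<or> T = convex hull {P, P + f_vec, P + g_vec})"

text \<open>Two distinct unit triangles are disjoint, meet in one lattice point, or share an edge;
  the condition \<open>P \<noteq> Q\<close> excludes the second case.\<close>
definition lozenge :: "(real \<times> real) set \<Rightarrow> bool" where
  "lozenge L \<longleftrightarrow> (\<exists>T T'. unit_triangle T \<and> unit_triangle T' \<and> T \<noteq> T' \<and>
     (\<exists>P Q. P \<noteq> Q \<and> T \<inter> T' = closed_segment P Q) \<and> L = T \<union> T')"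

definition lozenge_tiling :: "(real \<times> real) set \<Rightarrow> (real \<times> real) set set \<Rightarrow> bool" where
  "lozenge_tiling R \<T> \<longleftrightarrow> (\<forall>L\<in>\<T>. lozenge L) \<and>
     pairwise (\<lambda>L L'. interior L \<inter> interior L' = {}) \<T> \<and> \<Union>\<T> = R"

definition hexagon :: "nat \<Rightarrow> nat \<Rightarrow> nat \<Rightarrow> (real \<times> real) set" where
  "hexagon a b c = convex hull
     {0,
      real b *\<^sub>R e_vec,
      real b *\<^sub>R e_vec + real a *\<^sub>R f_vec,
      real b *\<^sub>R e_vec + real a *\<^sub>R f_vec + real c *\<^sub>R g_vec,
      real a *\<^sub>R f_vec + real c *\<^sub>R g_vec,
      real c *\<^sub>R g_vec}"

definition corner_cell ::
  "real \<times> real \<Rightarrow> real \<times> real \<Rightarrow> real \<times> real \<Rightarrow> nat \<Rightarrow> nat \<Rightarrow> (real \<times> real) set" where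
  "corner_cell V s t i j = convex hull
     {V + (real i - 1) *\<^sub>R s + (real j - 1) *\<^sub>R t,
      V + real i *\<^sub>R s + (real j - 1) *\<^sub>R t,
      V + real i *\<^sub>R s + real j *\<^sub>R t,
      V + (real i - 1) *\<^sub>R s + real j *\<^sub>R t}"

definition max_staircase ::
  "real \<times> real \<Rightarrow> real \<times> real \<Rightarrow> real \<times> real \<Rightarrow> nat \<Rightarrow> nat \<Rightarrow> (real \<times> real) set" where
  "max_staircase V s t p q =
     \<Union> {corner_cell V s t i j | i j. i \<ge> 1 \<and> j \<ge> 1 \<and> i + j \<le> min p q}"

definition marked_positions ::
  "real \<times> real \<Rightarrow> real \<times> real \<Rightarrow> real \<times> real \<Rightarrow> nat \<Rightarrow> nat \<Rightarrow> (real \<times> real) set set" where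
  "marked_positions V s t p q =
     {corner_cell V s t i j | i j. i \<ge> 1 \<and> j \<ge> 1 \<and> i + j = min p q + 1}"

text \<open>Removal in the sense of regions made of closed unit triangles: the cut stays in the
  boundary of the remaining region.\<close>
definition remove_region ::
  "(real \<times> real) set \<Rightarrow> (real \<times> real) set \<Rightarrow> (real \<times> real) set" where
  "remove_region R S = \<Union> {T. unit_triangle T \<and> T \<subseteq> R \<and> \<not> T \<subseteq> S}"

definition nw_corner :: "nat \<Rightarrow> nat \<Rightarrow> (real \<times> real)" where
  "nw_corner a c = real a *\<^sub>R f_vec + real c *\<^sub>R g_vec"

text \<open>From the northwestern corner, the side of length \<open>a\<close> runs in direction \<open>- f_vec\<close> and
  the side of length \<open>b\<close> in direction \<open>e_vec\<close>.\<close>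
definition H1 :: "nat \<Rightarrow> nat \<Rightarrow> nat \<Rightarrow> (real \<times> real) set" where
  "H1 a b c = remove_region (hexagon a b c) (max_staircase (nw_corner a c) (- f_vec) e_vec a b)"

definition nw_marked :: "nat \<Rightarrow> nat \<Rightarrow> nat \<Rightarrow> (real \<times> real) set set" where
  "nw_marked a b c = marked_positions (nw_corner a c) (- f_vec) e_vec a b"

definition Lstar_H1 :: "nat \<Rightarrow> nat \<Rightarrow> nat \<Rightarrow> real" where
  "Lstar_H1 a b c = (\<Sum>\<T> | lozenge_tiling (H1 a b c) \<T>. 1 / 2 ^ card (\<T> \<inter> nw_marked a b c))"

end

theory Submission
  imports Defs "Jordan_Normal_Form.Determinant"
begin

text \<open>
  Write a point of the plane as \<open>x e + y f\<close>. The lines \<open>x + y = k\<close>, for \<open>k = 0, \<dots>, a + b\<close>, are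
  parallel to \<open>g\<close> and cut the hexagon into strips. The unit edges of line \<open>k\<close> are named by
  their height \<open>j\<close>; edge \<open>(k, j)\<close> has an upward triangle on its left and a downward triangle on
  its right. A lozenge either consists of these two triangles (it spans \<open>e\<close> and \<open>f\<close>; call
  \<open>j\<close> a hole of line \<open>k\<close>), or it lies in one strip and leads from an edge of line \<open>k\<close> to an edge of
  line \<open>k + 1\<close>, at the same height or one unit higher. A tiling therefore is a sequence of sets
  \<open>S\<^sub>0, \<dots>, S\<^sub>a\<^sub>+\<^sub>b\<close>, the heights that are no holes, in which each set moves to the next one by a
  bijection that raises every element by 0 or 1, and such a bijection is unique
  (\<open>bij_betw_matchings_tilings\<close>, \<open>bij_betw_matchings_line_sequences\<close>).

  The first set is \<open>{0, \<dots>, c - 1}\<close> and the last one is \<open>{a, \<dots>, a + c - 1}\<close>. Since heights only grow,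
  and by at most 1 per strip, the straight sides of the region follow from these two ends. What
  remains is the zigzag cut: it bounds the heights on line \<open>k\<close> by \<open>c + \<lceil>k/2\<rceil>\<close>. The marked
  positions are the rhombi around the topmost edges of the lines \<open>1, 3, \<dots>, 2 a - 1\<close>, and such a position
  is occupied exactly if this edge is a hole. So the weighted number of tilings is a weighted
  number of sequences in front of a wall.

  This number is computed line by line. The holes of consecutive lines interlace
  (\<open>sum_step_eq_sum_box\<close>), so that a sum over all predecessors of a set is a sum over a box of
  hole positions. The claim \<open>weighted_count_eq_fdet\<close> is that the weighted number of sequences
  that end in \<open>T\<close> on line \<open>k\<close> equals \<open>det (p\<^sub>r(d\<^sub>i))\<close>, where the \<open>d\<^sub>i\<close> are the distances of the holes
  of \<open>T\<close> to the wall and \<open>p\<^sub>r\<close> is a central factorial polynomial, even for odd \<open>k\<close> and odd for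
  even \<open>k\<close>. The induction works because summation over a box acts on the rows of a determinant
  separately, because the odd and the even central factorials are discrete antiderivatives of
  each other, and because the weight 1/2 of a topmost hole is exactly what makes the
  contribution of the wall cancel against the antisymmetry of the odd polynomials.

  Up to constants, and a factor \<open>d\<^sub>i\<close> for each hole if \<open>k\<close> is even, the determinant is a Vandermonde
  determinant in the squares \<open>d\<^sub>i\<^sup>2\<close> (\<open>fdet_vandermonde_newton\<close>). On the last line the holes
  form two blocks, and the product over pairs of holes falls apart into the factors of the
  theorem (\<open>weighted_count_final\<close>).
\<close>

section \<open>Determinants of matrices given by their entry function\<close>

text \<open>The size of the matrix stays a term, so that it can change in an induction over lines.\<close>
definition fdet :: "nat \<Rightarrow> (nat \<Rightarrow> nat \<Rightarrow> real) \<Rightarrow> real" where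
  "fdet n A = Determinant.det (Matrix.mat n n (\<lambda>(i, j). A i j))"

lemma fdet_cong:
  assumes "\<And>i j. i < n \<Longrightarrow> j < n \<Longrightarrow> A i j = B i j"
  shows "fdet n A = fdet n B"
  unfolding fdet_def by (rule arg_cong[where f = Determinant.det]) (auto intro!: eq_matI simp: assms)

lemma fdet_leibniz:
  "fdet n A = (\<Sum>p | p permutes {0..<n}. signof p * (\<Prod>i<n. A i (p i)))"
proof -
  have "(\<Prod>i = 0..<n. Matrix.mat n n (\<lambda>(i, j). A i j) $$ (i, p i)) = (\<Prod>i<n. A i (p i))"
    if "p permutes {0..<n}" for p
    unfolding lessThan_atLeast0
    by (rule prod.cong) (use permutes_in_image[OF that] in auto)
  then show ?thesis
    unfolding fdet_def by (subst det_def'[of _ n]) (auto intro!: sum.cong)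
qed

lemma fdet_mult:
  "fdet n (\<lambda>i j. \<Sum>k<n. A i k * B k j) = fdet n A * fdet n B"
proof -
  have "Matrix.mat n n (\<lambda>(i, j). \<Sum>k<n. A i k * B k j)
      = Matrix.mat n n (\<lambda>(i, j). A i j) * Matrix.mat n n (\<lambda>(i, j). B i j)"
    by (rule eq_matI) (auto simp: scalar_prod_def lessThan_atLeast0)
  then show ?thesis
    unfolding fdet_def by (simp add: det_mult[of _ n])
qed

lemma fdet_lower_triangular:
  assumes "\<And>i j. i < j \<Longrightarrow> j < n \<Longrightarrow> A i j = 0"
  shows "fdet n A = (\<Prod>i<n. A i i)"
proof -
  have "prod_list (diag_mat (Matrix.mat n n (\<lambda>(i, j). A i j))) = (\<Prod>i<n. A i i)"
    by (simp add: prod_list_diag_prod lessThan_atLeast0)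
  then show ?thesis
    unfolding fdet_def by (subst det_lower_triangular[of n]) (auto simp: assms)
qed

lemma fdet_upper_triangular:
  assumes "\<And>i j. j < i \<Longrightarrow> i < n \<Longrightarrow> A i j = 0"
  shows "fdet n A = (\<Prod>i<n. A i i)"
proof -
  have "prod_list (diag_mat (Matrix.mat n n (\<lambda>(i, j). A i j))) = (\<Prod>i<n. A i i)"
    by (simp add: prod_list_diag_prod lessThan_atLeast0)
  then show ?thesis
    unfolding fdet_def by (subst det_upper_triangular[of _ n]) (auto simp: assms upper_triangular_def)
qed

text \<open>In every term of the Leibniz formula row \<open>i\<close> contributes one factor that depends on \<open>x i\<close> only; the
  sum over the box hence factors term by term.\<close>
lemma fdet_sum_box:
  assumes "\<And>i. i < n \<Longrightarrow> finite (I i)"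
  shows "(\<Sum>x\<in>Pi\<^sub>E {..<n} I. fdet n (\<lambda>i r. f i r (x i))) = fdet n (\<lambda>i r. \<Sum>y\<in>I i. f i r y)"
proof -
  have "(\<Sum>x\<in>Pi\<^sub>E {..<n} I. fdet n (\<lambda>i r. f i r (x i)))
      = (\<Sum>p | p permutes {0..<n}. signof p * (\<Sum>x\<in>Pi\<^sub>E {..<n} I. \<Prod>i<n. f i (p i) (x i)))"
    unfolding fdet_leibniz by (subst sum.swap) (simp add: sum_distrib_left)
  also have "\<dots> = (\<Sum>p | p permutes {0..<n}. signof p * (\<Prod>i<n. \<Sum>y\<in>I i. f i (p i) y))"
    by (subst prod_sum_PiE) (use assms in auto)
  finally show ?thesis
    unfolding fdet_leibniz .
qed

text \<open>The differences arise by multiplication with a unitriangular bidiagonal matrix.\<close>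
lemma fdet_row_diff_next:
  "fdet n (\<lambda>i r. if Suc i < n then P i r - P (Suc i) r else P i r) = fdet n P"
proof -
  define U where "U i k = (if k = i then 1 else if k = Suc i then -1 else (0::real))" for i k :: nat
  have "(\<Sum>k<n. U i k * P k r) = (if Suc i < n then P i r - P (Suc i) r else P i r)" if "i < n" for i r
  proof -
    have "(\<Sum>k<n. U i k * P k r) = (\<Sum>k<n. (if k = i then P i r else 0) + (if k = Suc i then - P (Suc i) r else 0))"
      by (rule sum.cong) (auto simp: U_def)
    also have "\<dots> = (if Suc i < n then P i r - P (Suc i) r else P i r)"
      using that by (simp add: sum.distrib)
    finally show ?thesis .
  qed
  then have "fdet n (\<lambda>i r. if Suc i < n then P i r - P (Suc i) r else P i r) = fdet n U * fdet n P"
    by (subst fdet_mult[symmetric]) (rule fdet_cong, simp)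
  also have "fdet n U = 1"
    by (subst fdet_upper_triangular) (auto simp: U_def)
  finally show ?thesis by simp
qed

text \<open>Subtracting from each row the previous one leaves only the top entry of the column of ones; expansion
  along this column removes it. This is how a sum over interlacing positions turns \<open>n\<close> holes into \<open>n + 1\<close>.\<close>
lemma fdet_row_diff_prev:
  assumes "\<And>i. i \<le> n \<Longrightarrow> M i 0 = 1"
  shows "fdet (Suc n) M = fdet n (\<lambda>i r. M (Suc i) (Suc r) - M i (Suc r))"
proof -
  define U where "U i k = (if k = i then 1 else if Suc k = i then -1 else (0::real))" for i k :: nat
  define N where "N i r = (if i = 0 then M 0 r else M i r - M (i - 1) r)" for i r
  have "(\<Sum>k<Suc n. U i k * M k r) = N i r" if "i < Suc n" for i r
  proof -
    have "(\<Sum>k<Suc n. U i k * M k r)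
        = (\<Sum>k<Suc n. (if k = i then M i r else 0) + (if Suc k = i then - M (i - 1) r else 0))"
      by (rule sum.cong) (auto simp: U_def)
    also have "\<dots> = N i r"
      using that by (cases i) (auto simp: sum.distrib N_def simp del: sum.lessThan_Suc)
    finally show ?thesis .
  qed
  then have "fdet (Suc n) N = fdet (Suc n) U * fdet (Suc n) M"
    by (subst fdet_mult[symmetric]) (rule fdet_cong, simp)
  also have "fdet (Suc n) U = 1"
    by (subst fdet_lower_triangular) (auto simp: U_def)
  finally have "fdet (Suc n) M = fdet (Suc n) N" by simp
  also have "\<dots> = fdet n (\<lambda>i r. M (Suc i) (Suc r) - M i (Suc r))"
  proof -
    let ?A = "Matrix.mat (Suc n) (Suc n) (\<lambda>(i, j). N i j)"
    have "Determinant.det ?A = (\<Sum>i<Suc n. ?A $$ (i, 0) * cofactor ?A i 0)"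
      by (rule laplace_expansion_column) auto
    also have "\<dots> = (\<Sum>i<Suc n. if i = 0 then cofactor ?A 0 0 else 0)"
      by (rule sum.cong) (auto simp: N_def assms)
    also have "\<dots> = Determinant.det (mat_delete ?A 0 0)"
      by (simp add: cofactor_def)
    also have "mat_delete ?A 0 0 = Matrix.mat n n (\<lambda>(i, r). M (Suc i) (Suc r) - M i (Suc r))"
      by (rule eq_matI) (auto simp: mat_delete_def N_def)
    finally show ?thesis
      by (simp add: fdet_def)
  qed
  finally show ?thesis .
qed

text \<open>Newton bases for two different sequences of nodes are related by a unitriangular matrix.\<close>
lemma newton_basis_change:
  fixes c d :: "nat \<Rightarrow> real"
  shows "\<exists>u. u r = 1 \<and> (\<forall>x. (\<Prod>l<r. c l - x) = (\<Sum>s\<le>r. u s * (\<Prod>l<s. d l - x)))"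
proof (induction r)
  case 0
  then show ?case by (auto intro!: exI[of _ "\<lambda>_. 1"])
next
  case (Suc r)
  then obtain u where u: "u r = 1" "\<And>x. (\<Prod>l<r. c l - x) = (\<Sum>s\<le>r. u s * (\<Prod>l<s. d l - x))"
    by blast
  \<comment> \<open>multiply by \<open>c r - x = (d s - x) + (c r - d s)\<close> in the term with index \<open>s\<close>\<close>
  define v where "v s = (if s = 0 then 0 else u (s - 1)) + (if s \<le> r then u s * (c r - d s) else 0)" for s
  have "(\<Prod>l<Suc r. c l - x) = (\<Sum>s\<le>Suc r. v s * (\<Prod>l<s. d l - x))" for x
  proof -
    let ?N = "\<lambda>s. \<Prod>l<s. d l - x"
    have "(\<Prod>l<Suc r. c l - x) = (\<Sum>s\<le>r. u s * ?N s) * (c r - x)"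
      by (simp add: u(2))
    also have "\<dots> = (\<Sum>s\<le>r. u s * ?N (Suc s)) + (\<Sum>s\<le>r. u s * (c r - d s) * ?N s)"
      unfolding sum_distrib_right sum.distrib[symmetric]
      by (rule sum.cong) (auto simp: algebra_simps)
    also have "(\<Sum>s\<le>r. u s * ?N (Suc s)) = (\<Sum>s\<le>Suc r. (if s = 0 then 0 else u (s - 1)) * ?N s)"
      by (subst sum.atMost_Suc_shift) simp
    also have "(\<Sum>s\<le>r. u s * (c r - d s) * ?N s)
        = (\<Sum>s\<le>Suc r. (if s \<le> r then u s * (c r - d s) else 0) * ?N s)"
      by simp
    finally show ?thesis
      by (simp only: v_def distrib_right sum.distrib)
  qed
  moreover have "v (Suc r) = 1"
    using u(1) by (simp add: v_def)
  ultimately show ?case by blast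
qed

text \<open>By the unitriangular change of basis the nodes \<open>c\<close> do not matter. With the nodes \<open>t\<close> themselves the
  matrix is lower triangular.\<close>
lemma fdet_vandermonde_newton:
  fixes c t :: "nat \<Rightarrow> real"
  shows "fdet n (\<lambda>i r. \<Prod>l<r. c l - t i) = (\<Prod>j<n. \<Prod>i<j. t i - t j)"
proof -
  obtain u where u: "\<And>r. u r r = 1"
      "\<And>r x. (\<Prod>l<r. c l - x) = (\<Sum>s\<le>r. u r s * (\<Prod>l<s. t l - x))"
    using newton_basis_change[of _ c t] by metis
  define V where "V s r = (if s \<le> r then u r s else 0)" for s r
  have "fdet n (\<lambda>i r. \<Prod>l<r. c l - t i) = fdet n (\<lambda>i r. \<Sum>s<n. (\<Prod>l<s. t l - t i) * V s r)"
  proof (rule fdet_cong)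
    fix i r assume "r < n"
    have "(\<Prod>l<r. c l - t i) = (\<Sum>s\<le>r. (\<Prod>l<s. t l - t i) * V s r)"
      unfolding u(2) by (rule sum.cong) (auto simp: V_def)
    also have "\<dots> = (\<Sum>s<n. (\<Prod>l<s. t l - t i) * V s r)"
      by (rule sum.mono_neutral_left) (use \<open>r < n\<close> in \<open>auto simp: V_def\<close>)
    finally show "(\<Prod>l<r. c l - t i) = (\<Sum>s<n. (\<Prod>l<s. t l - t i) * V s r)" .
  qed
  also have "\<dots> = fdet n (\<lambda>i s. \<Prod>l<s. t l - t i) * fdet n V"
    by (rule fdet_mult)
  also have "fdet n V = 1"
    by (subst fdet_upper_triangular) (auto simp: V_def u(1))
  also have "fdet n (\<lambda>i s. \<Prod>l<s. t l - t i) = (\<Prod>j<n. \<Prod>i<j. t i - t j)"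
    by (rule fdet_lower_triangular) (auto intro!: prod_zero)
  finally show ?thesis by simp
qed

lemma fdet_scale_rows_cols:
  "fdet n (\<lambda>i r. a i * b r * A i r) = (\<Prod>i<n. a i) * (\<Prod>r<n. b r) * fdet n A"
proof -
  have "(\<Prod>i<n. a i * b (p i) * A i (p i)) = (\<Prod>i<n. a i) * (\<Prod>r<n. b r) * (\<Prod>i<n. A i (p i))"
    if "p permutes {0..<n}" for p
    using prod.permute[OF that, of b] by (simp add: prod.distrib lessThan_atLeast0 comp_def)
  then show ?thesis
    unfolding fdet_leibniz by (auto simp: sum_distrib_left intro!: sum.cong)
qed

section \<open>Holes of a set of positions and their interlacing\<close>

text \<open>The infinite complement is enumerated, so that two sets of equal size have comparable holes for every
  index and no case distinction at the upper end is needed.\<close>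
definition hole :: "nat set \<Rightarrow> nat \<Rightarrow> nat" where
  "hole S = enumerate (- S)"

text \<open>The occupied heights of two consecutive lines: each lozenge inside the strip keeps the height or raises it by one.\<close>
definition step :: "nat set \<Rightarrow> nat set \<Rightarrow> bool" where
  "step S T \<longleftrightarrow> (\<exists>\<beta>. bij_betw \<beta> S T \<and> (\<forall>s\<in>S. \<beta> s = s \<or> \<beta> s = Suc s))"

text \<open>This translates between the positions of an enumeration and the counting function of its range; below, the
  counting functions of a set and of its complement determine each other.\<close>
lemma strict_mono_less_iff_card:
  fixes x :: "nat \<Rightarrow> nat"
  assumes "strict_mono x"
  shows "x i < t \<longleftrightarrow> i < card (range x \<inter> {..<t})"
proof
  assume "x i < t"
  then have "x j < t" if "j \<le> i" for j
    using that strict_mono_less_eq[OF assms, of j i] by simp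
  then have "x ` {..i} \<subseteq> range x \<inter> {..<t}" by auto
  then have "card (x ` {..i}) \<le> card (range x \<inter> {..<t})"
    by (intro card_mono) auto
  then show "i < card (range x \<inter> {..<t})"
    using strict_mono_imp_inj_on[OF assms] by (simp add: card_image inj_on_subset)
next
  assume *: "i < card (range x \<inter> {..<t})"
  show "x i < t"
  proof (rule ccontr)
    assume "\<not> x i < t"
    then have "j < i" if "x j < t" for j
      using that strict_mono_less[OF assms, of j i] by simp
    then have "range x \<inter> {..<t} \<subseteq> x ` {..<i}" by auto
    then have "card (range x \<inter> {..<t}) \<le> card (x ` {..<i})"
      by (intro card_mono) auto
    also have "\<dots> \<le> i"
      using card_image_le[of "{..<i}" x] by simp
    finally show False using * by simp
  qed
qed

lemma strict_mono_hole: "finite S \<Longrightarrow> strict_mono (hole S)"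
  unfolding hole_def by (rule strict_mono_enumerate) (simp add: Compl_eq_Diff_UNIV)

lemma range_hole: "finite S \<Longrightarrow> range (hole S) = - S"
  unfolding hole_def by (rule range_enumerate) (simp add: Compl_eq_Diff_UNIV)

lemma hole_notin: "finite S \<Longrightarrow> hole S i \<notin> S"
  using range_hole[of S] by auto

lemma hole_ex: "finite S \<Longrightarrow> y \<notin> S \<Longrightarrow> \<exists>i. y = hole S i"
  using range_hole[of S] by auto

lemma hole_less_iff_card: "finite S \<Longrightarrow> hole S i < t \<longleftrightarrow> i < card ({..<t} - S)"
  using strict_mono_less_iff_card[OF strict_mono_hole, of S i t]
  by (simp add: range_hole Diff_eq Int_commute)

lemma hole_unique:
  fixes x :: "nat \<Rightarrow> nat"
  assumes "finite S" "strict_mono x" "range x = - S"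
  shows "hole S = x"
proof
  fix i
  have "hole S i < t \<longleftrightarrow> x i < t" for t
    using strict_mono_less_iff_card[OF assms(2), of i t] hole_less_iff_card[OF assms(1), of i t] assms(3)
    by (simp add: Diff_eq Int_commute)
  from this[of "hole S i"] this[of "x i"] show "hole S i = x i" by simp
qed

text \<open>Above all elements of \<open>S\<close> the number of skipped elements is \<open>card S\<close>.\<close>
lemma hole_beyond:
  assumes "S \<subseteq> {..<card S + n}" "n \<le> i"
  shows "hole S i = card S + i"
proof -
  have fin: "finite S" using assms(1) finite_subset by blast
  have "card ({..<t} - S) = t - card S" if "card S + n \<le> t" for t
  proof -
    have "S \<subseteq> {..<t}" using assms(1) that by (meson lessThan_subset_iff order_trans)
    then show ?thesis using card_Diff_subset[OF fin, of "{..<t}"] by simp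
  qed
  from this[of "card S + i"] this[of "card S + Suc i"]
  have "card ({..<card S + i} - S) = i" "card ({..<card S + Suc i} - S) = Suc i"
    using assms(2) by simp_all
  then have "\<not> hole S i < card S + i" "hole S i < card S + Suc i"
    by (simp_all only: hole_less_iff_card[OF fin] less_irrefl lessI not_False_eq_True)
  then show ?thesis by linarith
qed

lemma hole_within:
  assumes "S \<subseteq> {..<card S + n}" "i < n"
  shows "hole S i < card S + n"
proof -
  have fin: "finite S" using assms(1) finite_subset by blast
  have "card ({..<card S + n} - S) = n"
    using card_Diff_subset[OF fin assms(1)] by simp
  then show ?thesis using hole_less_iff_card[OF fin] assms(2) by simp
qed

text \<open>A step raises elements by at most one, so the number of elements below \<open>t\<close> cannot increase, and cannot drop
  below its old value if \<open>t\<close> is raised by one. For the complements these are the two inequalities.\<close>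
lemma step_imp_interlacing:
  assumes "finite S" "step S T"
  shows "hole T i \<le> hole S i" "hole S i < hole T (Suc i)"
proof -
  obtain \<beta> where \<beta>: "bij_betw \<beta> S T" "\<And>s. s \<in> S \<Longrightarrow> \<beta> s = s \<or> \<beta> s = Suc s"
    using assms(2) unfolding step_def by blast
  have finT: "finite T" using bij_betw_finite[OF \<beta>(1)] assms(1) by simp
  have cS: "card ({..<t} - S) + card (S \<inter> {..<t}) = t" for t
    using card_Int_Diff[of "{..<t}" S] by (simp add: Int_commute)
  have cT: "card ({..<t} - T) + card (T \<inter> {..<t}) = t" for t
    using card_Int_Diff[of "{..<t}" T] by (simp add: Int_commute)
  have le1: "card (T \<inter> {..<t}) \<le> card (S \<inter> {..<t})" for t
  proof (rule surj_card_le)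
    show "T \<inter> {..<t} \<subseteq> \<beta> ` (S \<inter> {..<t})"
    proof
      fix y assume y: "y \<in> T \<inter> {..<t}"
      then obtain s where "s \<in> S" "y = \<beta> s" using \<beta>(1) by (auto simp: bij_betw_def)
      with \<beta>(2)[of s] y show "y \<in> \<beta> ` (S \<inter> {..<t})" by auto
    qed
  qed auto
  have le2: "card (S \<inter> {..<t}) \<le> card (T \<inter> {..<Suc t})" for t
  proof (rule card_inj_on_le)
    show "inj_on \<beta> (S \<inter> {..<t})" using \<beta>(1) by (auto simp: bij_betw_def inj_on_def)
    show "\<beta> ` (S \<inter> {..<t}) \<subseteq> T \<inter> {..<Suc t}"
      using \<beta> by (fastforce simp: bij_betw_def)
  qed auto
  have "i < card ({..<Suc (hole S i)} - S)"
    using hole_less_iff_card[OF assms(1), of i "Suc (hole S i)"] by simp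
  also have "\<dots> \<le> card ({..<Suc (hole S i)} - T)"
    using le1[of "Suc (hole S i)"] cS[of "Suc (hole S i)"] cT[of "Suc (hole S i)"] by linarith
  finally show "hole T i \<le> hole S i"
    using hole_less_iff_card[OF finT, of i "Suc (hole S i)"] by simp
  let ?t = "hole T (Suc i)"
  have "Suc i < card ({..<Suc ?t} - T)"
    using hole_less_iff_card[OF finT, of "Suc i" "Suc ?t"] by simp
  then have "i < card ({..<?t} - S)"
    using le2[of ?t] cS[of ?t] cT[of "Suc ?t"] by linarith
  then show "hole S i < hole T (Suc i)"
    using hole_less_iff_card[OF assms(1), of i ?t] by simp
qed

text \<open>The elements that have to be raised are those between a new hole and the old hole of the same index: the old
  hole is filled by the run of elements below it, each of which moves up by one.\<close>
lemma interlacing_imp_step: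
  assumes fin: "finite S" "finite T"
    and inter: "\<And>i. hole T i \<le> hole S i" "\<And>i. hole S i < hole T (Suc i)"
  shows "step S T"
proof -
  \<comment> \<open>the elements that move up\<close>
  define F where "F = (\<Union>i. {hole T i..<hole S i})"
  have between: "y \<notin> - S" if "hole T i \<le> y" "y < hole S i" for i y
  proof
    assume "y \<in> - S"
    then obtain l where l: "y = hole S l" using hole_ex[OF fin(1)] by auto
    with that have "l < i" using strict_mono_less[OF strict_mono_hole[OF fin(1)]] by simp
    then have "hole T (Suc l) \<le> hole T i"
      using strict_mono_less_eq[OF strict_mono_hole[OF fin(2)]] by simp
    then show False using inter(2)[of l] l that by simp
  qed
  have FS: "F \<subseteq> S" unfolding F_def using between by auto
  define \<beta> where "\<beta> s = (if s \<in> F then Suc s else s)" for s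
  have inT: "\<beta> s \<in> T" if s: "s \<in> S" for s
  proof (cases "s \<in> F")
    case True
    then obtain i where i: "hole T i \<le> s" "s < hole S i" by (auto simp: F_def)
    have "Suc s \<in> T"
    proof (rule ccontr)
      assume "Suc s \<notin> T"
      then obtain l where l: "Suc s = hole T l" using hole_ex[OF fin(2)] by auto
      have "hole T i < hole T l" "hole T l < hole T (Suc i)"
        using i l inter(2)[of i] by auto
      then show False using strict_mono_less[OF strict_mono_hole[OF fin(2)]] by simp
    qed
    then show ?thesis using True by (simp add: \<beta>_def)
  next
    case False
    have "s \<in> T"
    proof (rule ccontr)
      assume "s \<notin> T"
      then obtain l where l: "s = hole T l" using hole_ex[OF fin(2)] by auto
      then have "s \<le> hole S l" "s \<noteq> hole S l"
        using inter(1)[of l] hole_notin[OF fin(1), of l] s by auto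
      then show False using False l by (auto simp: F_def)
    qed
    then show ?thesis using False by (simp add: \<beta>_def)
  qed
  have next_F: "Suc s \<in> F" if "s \<in> F" "Suc s \<in> S" for s
  proof -
    obtain i where i: "hole T i \<le> s" "s < hole S i" using \<open>s \<in> F\<close> by (auto simp: F_def)
    have "Suc s \<noteq> hole S i" using hole_notin[OF fin(1), of i] that by auto
    then show ?thesis using i by (auto simp: F_def intro!: exI[of _ i])
  qed
  have inj: "inj_on \<beta> S"
  proof (rule inj_onI)
    fix s s' assume *: "s \<in> S" "s' \<in> S" "\<beta> s = \<beta> s'"
    show "s = s'"
      using next_F[of s] next_F[of s'] * unfolding \<beta>_def by (cases "s \<in> F"; cases "s' \<in> F") simp_all
  qed
  have surj: "y \<in> \<beta> ` S" if y: "y \<in> T" for y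
  proof (cases "y \<in> S \<and> y \<notin> F")
    case True
    then show ?thesis by (auto simp: \<beta>_def intro!: image_eqI[of _ _ y])
  next
    case False
    then obtain l where l: "hole T l \<le> y" "y \<le> hole S l"
    proof (cases "y \<in> S")
      case True
      then show ?thesis using False that by (auto simp: F_def)
    next
      case False
      then obtain l where "y = hole S l" using hole_ex[OF fin(1)] by auto
      then show ?thesis using that inter(1)[of l] by auto
    qed
    moreover have "hole T l \<noteq> y" using hole_notin[OF fin(2), of l] y by auto
    ultimately have "hole T l \<le> y - 1" "y - 1 < hole S l" "Suc (y - 1) = y" by auto
    then have "y - 1 \<in> F" "Suc (y - 1) = y" unfolding F_def by auto
    then show ?thesis using FS by (auto simp: \<beta>_def intro!: image_eqI[of _ _ "y - 1"])
  qed
  have "bij_betw \<beta> S T" using inj inT surj by (auto simp: bij_betw_def)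
  moreover have "\<forall>s\<in>S. \<beta> s = s \<or> \<beta> s = Suc s" by (simp add: \<beta>_def)
  ultimately show ?thesis unfolding step_def by blast
qed

text \<open>A predecessor of \<open>T\<close> is determined by its \<open>n\<close> lowest holes, which range freely over the gaps between
  consecutive holes of \<open>T\<close>. The bound \<open>n\<close> or \<open>n + 1\<close> on the number of holes of \<open>T\<close> reflects that the wall
  recedes by one unit on every second line.\<close>
lemma sum_step_eq_sum_box:
  fixes g :: "(nat \<Rightarrow> nat) \<Rightarrow> real"
  assumes T: "T \<subseteq> {..<card T + n'}" and n: "n \<le> n'" "n' \<le> Suc n"
  shows "(\<Sum>S | S \<subseteq> {..<card T + n} \<and> step S T. g (restrict (hole S) {..<n}))
       = (\<Sum>x\<in>(\<Pi>\<^sub>E i\<in>{..<n}. {hole T i..<hole T (Suc i)}). g x)"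
proof (rule sum.reindex_bij_betw)
  let ?c = "card T"
  have finT: "finite T" using T finite_subset by blast
  show "bij_betw (\<lambda>S. restrict (hole S) {..<n}) {S. S \<subseteq> {..<?c + n} \<and> step S T}
          (\<Pi>\<^sub>E i\<in>{..<n}. {hole T i..<hole T (Suc i)})"
  proof (rule bij_betwI')
    fix S S' assume S: "S \<in> {S. S \<subseteq> {..<?c + n} \<and> step S T}" and S': "S' \<in> {S. S \<subseteq> {..<?c + n} \<and> step S T}"
    have fin: "finite S" "finite S'" using S S' finite_subset by blast+
    have card: "card S = ?c" "card S' = ?c" using S S' by (auto simp: step_def dest: bij_betw_same_card)
    show "(restrict (hole S) {..<n} = restrict (hole S') {..<n}) = (S = S')"
    proof
      assume eq: "restrict (hole S) {..<n} = restrict (hole S') {..<n}"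
      have "hole S i = hole S' i" for i
      proof (cases "i < n")
        case True
        then show ?thesis using fun_cong[OF eq, of i] by simp
      next
        case False
        then have "hole S i = ?c + i" "hole S' i = ?c + i"
          using hole_beyond[of S n i] hole_beyond[of S' n i] S S' unfolding card by simp_all
        then show ?thesis by simp
      qed
      then have "hole S = hole S'" by (rule ext)
      then have "- S = - S'" using range_hole[OF fin(1)] range_hole[OF fin(2)] by metis
      then show "S = S'" by blast
    qed simp
  next
    fix S assume S: "S \<in> {S. S \<subseteq> {..<?c + n} \<and> step S T}"
    then have "finite S" using finite_subset by blast
    then have "hole S i \<in> {hole T i..<hole T (Suc i)}" for i
      using step_imp_interlacing[of S T i] S unfolding mem_Collect_eq atLeastLessThan_iff by blast
    then show "restrict (hole S) {..<n} \<in> (\<Pi>\<^sub>E i\<in>{..<n}. {hole T i..<hole T (Suc i)})"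
      unfolding restrict_PiE_iff by blast
  next
    fix x assume x: "x \<in> (\<Pi>\<^sub>E i\<in>{..<n}. {hole T i..<hole T (Suc i)})"
    \<comment> \<open>beyond index \<open>n\<close> the holes of a predecessor are forced\<close>
    define X where "X i = (if i < n then x i else ?c + i)" for i
    have X: "hole T i \<le> X i" "X i < hole T (Suc i)" for i
    proof -
      have "hole T i \<le> X i \<and> X i < hole T (Suc i)"
      proof (cases "i < n")
        case True
        then show ?thesis using x by (auto simp: X_def PiE_iff)
      next
        case False
        then have "hole T (Suc i) = ?c + Suc i" using hole_beyond[OF T] n by simp
        moreover have "hole T i \<le> ?c + i"
        proof (cases "n' \<le> i")
          case True
          then show ?thesis using hole_beyond[OF T] by simp
        next
          case False
          then show ?thesis using hole_within[OF T, of i] \<open>\<not> i < n\<close> n by simp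
        qed
        ultimately show ?thesis using False by (simp add: X_def)
      qed
      then show "hole T i \<le> X i" "X i < hole T (Suc i)" by auto
    qed
    have mono: "strict_mono X"
      unfolding strict_mono_Suc_iff using less_le_trans[OF X(2) X(1)] by blast
    define S where "S = - range X"
    have "{?c + n..} \<subseteq> range X"
    proof
      fix y assume "y \<in> {?c + n..}"
      then have "X (y - ?c) = y" by (auto simp: X_def)
      then show "y \<in> range X" by (metis rangeI)
    qed
    then have sub: "S \<subseteq> {..<?c + n}" unfolding S_def using linorder_not_less by blast
    then have finS: "finite S" using finite_subset by blast
    have hole: "hole S = X" by (rule hole_unique[OF finS mono]) (simp add: S_def)
    have "step S T" by (rule interlacing_imp_step[OF finS finT]) (use X hole in auto)
    moreover have "x = restrict (hole S) {..<n}"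
      unfolding hole using x by (auto simp: X_def PiE_iff extensional_def fun_eq_iff)
    ultimately show "\<exists>S\<in>{S. S \<subseteq> {..<?c + n} \<and> step S T}. x = restrict (hole S) {..<n}"
      using sub by blast
  qed
qed

section \<open>Weighted sequences in front of a zigzag wall\<close>

text \<open>The heights on line \<open>k\<close> are bounded by \<open>c + \<lceil>k/2\<rceil>\<close>, the position of the zigzag.\<close>
definition row_end :: "nat \<Rightarrow> nat \<Rightarrow> nat" where
  "row_end c k = c + Suc k div 2"

text \<open>For odd \<open>k\<close> the topmost height is \<open>c + k div 2\<close>; the edge there is the diagonal of a marked position.\<close>
definition wall_weight :: "nat \<Rightarrow> nat \<Rightarrow> nat set \<Rightarrow> real" where
  "wall_weight c k S = (if odd k \<and> c + k div 2 \<notin> S then 1 / 2 else 1)"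

fun weighted_count :: "nat \<Rightarrow> nat \<Rightarrow> nat set \<Rightarrow> real" where
  "weighted_count c 0 T = (if T = {..<c} then 1 else 0)"
| "weighted_count c (Suc k) T =
     (\<Sum>S | S \<subseteq> {..<row_end c k} \<and> step S T. wall_weight c k S * weighted_count c k S)"

text \<open>Central factorial polynomials, divided by the factorial of their degree \<open>2 r\<close> or \<open>2 r + 1\<close>, with reversed
  sign of each quadratic factor. The sign compensates that distances to the wall decrease as heights increase.\<close>
definition central_factorial :: "nat \<Rightarrow> nat \<Rightarrow> real \<Rightarrow> real" where
  "central_factorial k r e = (if odd k then (\<Prod>l<r. (real l)\<^sup>2 - e\<^sup>2) / fact (2 * r)
                 else e * (\<Prod>l<r. (real l + 1 / 2)\<^sup>2 - e\<^sup>2) / fact (2 * r + 1))"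

text \<open>Distance to the common axis of symmetry of the central factorials; at fixed height it grows by 1/2 per line.\<close>
definition wall_dist :: "nat \<Rightarrow> nat \<Rightarrow> nat \<Rightarrow> real" where
  "wall_dist c k y = real c + (real k - 1) / 2 - real y"

text \<open>A telescoping criterion: it applies when two products share all factors but those at the ends.\<close>
lemma prod_lessThan_Suc_shifted:
  fixes u v h :: "nat \<Rightarrow> real"
  assumes "u 0 = h 0" and "\<And>r. h r * u (Suc r) = v r * h (Suc r)"
  shows "(\<Prod>l<Suc r. u l) = (\<Prod>l<r. v l) * h r"
proof (induction r)
  case 0
  then show ?case by (simp add: assms(1))
next
  case (Suc r)
  have "(\<Prod>l<Suc (Suc r). u l) = (\<Prod>l<r. v l) * (h r * u (Suc r))"
    by (subst prod.lessThan_Suc) (simp only: Suc.IH mult.assoc)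
  then show ?case by (simp only: assms(2) prod.lessThan_Suc mult.assoc)
qed

text \<open>Both products on the left contain all factors of the right hand side; the remaining factors at the two ends
  combine to \<open>(2 r + 2) e\<close>.\<close>
lemma central_factorial_diff_even:
  assumes "even k"
  shows "central_factorial (Suc k) (Suc r) (e - 1 / 2) - central_factorial (Suc k) (Suc r) (e + 1 / 2) = central_factorial k r e"
proof -
  have minus: "(\<Prod>l<Suc r. (real l)\<^sup>2 - (e - 1 / 2)\<^sup>2)
      = (\<Prod>l<r. (real l + 1 / 2)\<^sup>2 - e\<^sup>2) * ((real r + 1 / 2 - e) * (e - 1 / 2))" for r
    by (rule prod_lessThan_Suc_shifted) (simp_all add: field_simps power2_eq_square)
  have plus: "(\<Prod>l<Suc r. (real l)\<^sup>2 - (e + 1 / 2)\<^sup>2)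
      = (\<Prod>l<r. (real l + 1 / 2)\<^sup>2 - e\<^sup>2) * (- (e + 1 / 2) * (real r + 1 / 2 + e))" for r
    by (rule prod_lessThan_Suc_shifted) (simp_all add: field_simps power2_eq_square)
  define B where "B = (\<Prod>l<r. (real l + 1 / 2)\<^sup>2 - e\<^sup>2)"
  have "(\<Prod>l<Suc r. (real l)\<^sup>2 - (e - 1 / 2)\<^sup>2) - (\<Prod>l<Suc r. (real l)\<^sup>2 - (e + 1 / 2)\<^sup>2)
      = real (2 * r + 2) * (e * B)"
    unfolding minus plus B_def[symmetric] by (simp add: algebra_simps)
  then have "central_factorial (Suc k) (Suc r) (e - 1 / 2) - central_factorial (Suc k) (Suc r) (e + 1 / 2)
      = real (2 * r + 2) * (e * B) / fact (2 * r + 2)"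
    using assms by (simp add: central_factorial_def flip: diff_divide_distrib del: prod.lessThan_Suc fact_Suc)
  also have "\<dots> = e * B / fact (2 * r + 1)"
    by (simp add: divide_simps del: of_nat_add of_nat_mult)
  finally show ?thesis
    using assms by (simp add: central_factorial_def B_def)
qed

lemma central_factorial_diff_odd:
  assumes "odd k"
  shows "central_factorial (Suc k) r (e + 1 / 2) - central_factorial (Suc k) r (e - 1 / 2) = central_factorial k r e"
proof (cases r)
  case 0
  then show ?thesis using assms by (simp add: central_factorial_def)
next
  case (Suc s)
  define A where "A = (\<Prod>l<s. (real l + 1)\<^sup>2 - e\<^sup>2)"
  have plus: "(\<Prod>l<Suc s. (real l + 1 / 2)\<^sup>2 - (e + 1 / 2)\<^sup>2) = (\<Prod>l<s. (real l + 1)\<^sup>2 - e\<^sup>2) * (- e * (real s + 1 + e))" for s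
    by (rule prod_lessThan_Suc_shifted) (simp_all add: field_simps power2_eq_square)
  have minus: "(\<Prod>l<Suc s. (real l + 1 / 2)\<^sup>2 - (e - 1 / 2)\<^sup>2) = (\<Prod>l<s. (real l + 1)\<^sup>2 - e\<^sup>2) * (e * (real s + 1 - e))" for s
    by (rule prod_lessThan_Suc_shifted) (simp_all add: field_simps power2_eq_square)
  have zero: "(\<Prod>l<Suc s. (real l)\<^sup>2 - e\<^sup>2) = - e\<^sup>2 * A"
    unfolding A_def by (subst prod.lessThan_Suc_shift) (simp add: add.commute)
  have "(e + 1 / 2) * (\<Prod>l<Suc s. (real l + 1 / 2)\<^sup>2 - (e + 1 / 2)\<^sup>2)
      - (e - 1 / 2) * (\<Prod>l<Suc s. (real l + 1 / 2)\<^sup>2 - (e - 1 / 2)\<^sup>2)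
      = real (2 * r + 1) * (- e\<^sup>2 * A)"
    unfolding minus plus A_def[symmetric] Suc by (simp add: algebra_simps power2_eq_square)
  then have "central_factorial (Suc k) r (e + 1 / 2) - central_factorial (Suc k) r (e - 1 / 2)
      = real (2 * r + 1) * (- e\<^sup>2 * A) / fact (2 * r + 1)"
    unfolding Suc using assms
    by (simp add: central_factorial_def flip: diff_divide_distrib del: prod.lessThan_Suc fact_Suc mult_Suc_right)
  also have "\<dots> = - e\<^sup>2 * A / fact (2 * r)"
    by (simp add: divide_simps del: of_nat_add of_nat_mult)
  finally show ?thesis
    unfolding Suc using assms zero by (simp add: central_factorial_def del: prod.lessThan_Suc fact_Suc mult_Suc_right)
qed

lemma central_factorial_even_minus: "even k \<Longrightarrow> central_factorial k r (- e) = - central_factorial k r e"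
  by (simp add: central_factorial_def)

text \<open>This form of the weight can be distributed over the rows of a determinant.\<close>
lemma wall_weight_eq_prod:
  assumes "odd k" "S \<subseteq> {..<row_end c k}" "card S = c"
  shows "wall_weight c k S = (\<Prod>i<Suc k div 2. if hole S i = c + k div 2 then 1 / 2 else 1)"
proof -
  define n where "n = Suc k div 2"
  have fin: "finite S" using assms(2) finite_subset by blast
  have inj: "hole S i = hole S j \<Longrightarrow> i = j" for i j
    using strict_mono_eq[OF strict_mono_hole[OF fin]] by blast
  show ?thesis
  proof (cases "c + k div 2 \<in> S")
    case True
    then have "hole S i \<noteq> c + k div 2" for i
      using hole_notin[OF fin, of i] by auto
    then show ?thesis using True by (simp add: wall_weight_def)
  next
    case False
    then obtain i where i: "c + k div 2 = hole S i" using hole_ex[OF fin] by blast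
    have "i < n"
    proof (rule ccontr)
      assume "\<not> i < n"
      then have "hole S i = c + i" using hole_beyond[of S n i] assms by (simp add: row_end_def n_def)
      moreover have "k div 2 < n" using assms(1) by (auto simp: n_def elim!: oddE)
      ultimately show False using i \<open>\<not> i < n\<close> by simp
    qed
    have "(\<Prod>j<n. if hole S j = c + k div 2 then 1 / 2 else 1) = (\<Prod>j<n. if j = i then 1 / 2 else (1::real))"
      unfolding i using inj by (intro prod.cong) auto
    also have "\<dots> = 1 / 2" using \<open>i < n\<close> by simp
    finally show ?thesis using False assms(1) by (simp add: wall_weight_def n_def)
  qed
qed

text \<open>Induction over the lines. The rows of the determinant for line \<open>k + 1\<close> are sums over intervals between
  holes, which telescope by the difference equations of the central factorials. From an even to an odd line
  the number of holes grows and the constant polynomial supplies the additional column. From an odd to an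
  even line only the last interval reaches the wall.\<close>
lemma weighted_count_eq_fdet:
  assumes "T \<subseteq> {..<row_end c k}" "card T = c"
  shows "weighted_count c k T = fdet (Suc k div 2) (\<lambda>i r. central_factorial k r (wall_dist c k (hole T i)))"
  using assms
proof (induction k arbitrary: T)
  case 0
  then have "T = {..<c}" by (simp add: row_end_def card_subset_eq)
  then show ?case by (simp add: fdet_def)
next
  case (Suc k)
  define n where "n = Suc k div 2"
  define n' where "n' = Suc (Suc k) div 2"
  define z where "z = hole T"
  define w where "w y = (if odd k \<and> y = c + k div 2 then 1 / 2 else (1::real))" for y
  define f where "f r y = w y * central_factorial k r (wall_dist c k y)" for r y
  have T: "T \<subseteq> {..<card T + n'}" using Suc.prems by (simp add: row_end_def n'_def)
  have fin: "finite T" using T finite_subset by blast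
  have nn: "n \<le> n'" "n' \<le> Suc n" by (auto simp: n_def n'_def)
  have zmono: "z i \<le> z (Suc i)" for i
    using strict_mono_less_eq[OF strict_mono_hole[OF fin]] by (simp add: z_def)
  have "weighted_count c (Suc k) T
      = (\<Sum>S | S \<subseteq> {..<row_end c k} \<and> step S T. fdet n (\<lambda>i r. f r (hole S i)))"
  proof -
    have "wall_weight c k S * weighted_count c k S = fdet n (\<lambda>i r. f r (hole S i))"
      if S: "S \<subseteq> {..<row_end c k}" "step S T" for S
    proof -
      have card: "card S = c" using S(2) Suc.prems(2) by (auto simp: step_def dest: bij_betw_same_card)
      have "wall_weight c k S = (\<Prod>i<n. w (hole S i))"
      proof (cases "odd k")
        case True
        then show ?thesis using wall_weight_eq_prod[OF True S(1) card] by (simp add: w_def n_def)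
      next
        case False
        then show ?thesis by (simp add: w_def wall_weight_def)
      qed
      then show ?thesis
        using fdet_scale_rows_cols[of n "\<lambda>i. w (hole S i)" "\<lambda>r. 1" "\<lambda>i r. central_factorial k r (wall_dist c k (hole S i))"]
        unfolding Suc.IH[OF S(1) card] f_def n_def by simp
    qed
    then show ?thesis by (auto intro!: sum.cong)
  qed
  also have "\<dots> = (\<Sum>S | S \<subseteq> {..<card T + n} \<and> step S T. fdet n (\<lambda>i r. f r (restrict (hole S) {..<n} i)))"
    by (rule sum.cong) (auto simp: Suc.prems(2) row_end_def n_def intro!: fdet_cong)
  also have "\<dots> = (\<Sum>x\<in>(\<Pi>\<^sub>E i\<in>{..<n}. {z i..<z (Suc i)}). fdet n (\<lambda>i r. f r (x i)))"
    unfolding z_def by (rule sum_step_eq_sum_box[OF T nn])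
  also have "\<dots> = fdet n (\<lambda>i r. \<Sum>y\<in>{z i..<z (Suc i)}. f r y)"
    by (rule fdet_sum_box) simp
  also have "\<dots> = fdet n' (\<lambda>i r. central_factorial (Suc k) r (wall_dist c (Suc k) (z i)))"
  proof (cases "even k")
    case True
    have n': "n' = Suc n" using True by (auto simp: n_def n'_def elim!: evenE)
    have "f r y = central_factorial (Suc k) (Suc r) (wall_dist c (Suc k) (Suc y)) - central_factorial (Suc k) (Suc r) (wall_dist c (Suc k) y)" for r y
    proof -
      have "wall_dist c (Suc k) (Suc y) = wall_dist c k y - 1 / 2" "wall_dist c (Suc k) y = wall_dist c k y + 1 / 2"
        by (simp_all add: wall_dist_def field_simps)
      then show ?thesis using central_factorial_diff_even[OF True, of r "wall_dist c k y"] True by (simp add: f_def w_def)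
    qed
    then have "(\<Sum>y\<in>{z i..<z (Suc i)}. f r y)
        = central_factorial (Suc k) (Suc r) (wall_dist c (Suc k) (z (Suc i))) - central_factorial (Suc k) (Suc r) (wall_dist c (Suc k) (z i))" for r i
      using sum_Suc_diff'[OF zmono[of i], of "\<lambda>y. central_factorial (Suc k) (Suc r) (wall_dist c (Suc k) y)"] by simp
    moreover have "central_factorial (Suc k) 0 e = 1" for e using True by (simp add: central_factorial_def)
    ultimately show ?thesis
      unfolding n' by (subst fdet_row_diff_prev) auto
  next
    case False
    then have k: "Suc k = 2 * n" "n' = n" "k div 2 = n - 1" "0 < n" by (auto simp: n_def n'_def elim!: oddE)
    define P where "P r y = central_factorial (Suc k) r (wall_dist c (Suc k) y)" for r y
    have dP: "central_factorial k r (wall_dist c k y) = P r y - P r (Suc y)" for r y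
    proof -
      have "wall_dist c (Suc k) (Suc y) = wall_dist c k y - 1 / 2" "wall_dist c (Suc k) y = wall_dist c k y + 1 / 2"
        by (simp_all add: wall_dist_def field_simps)
      then show ?thesis using central_factorial_diff_odd[OF False, of r "wall_dist c k y"] by (simp add: P_def)
    qed
    have zn: "z n = c + n" using hole_beyond[OF T, of n] Suc.prems(2) k by (simp add: z_def)
    have zle: "z (Suc i) \<le> c + n - 1" if "Suc i < n" for i
      using hole_within[OF T, of "Suc i"] that k Suc.prems(2) by (simp add: z_def)
    have sumP: "(\<Sum>y\<in>{a..<b}. f r y) = P r a - P r b" if "a \<le> b" "b \<le> c + n - 1" for a b r
    proof -
      have "(\<Sum>y\<in>{a..<b}. f r y) = (\<Sum>y\<in>{a..<b}. - P r (Suc y) - - P r y)"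
        using that k by (intro sum.cong) (auto simp: f_def w_def dP)
      then show ?thesis using sum_Suc_diff'[OF that(1), of "\<lambda>y. - P r y"] by simp
    qed
    have "(\<Sum>y\<in>{z i..<z (Suc i)}. f r y) = (if Suc i < n then P r (z i) - P r (z (Suc i)) else P r (z i))"
      if "i < n" for i r
    proof (cases "Suc i < n")
      case True
      then show ?thesis using sumP[OF zmono zle] by simp
    next
      case False
      then have i: "Suc i = n" using that by simp
      have zi: "z i \<le> c + n - 1" using hole_within[OF T, of i] i k Suc.prems(2) by (simp add: z_def)
      have "{z i..<z (Suc i)} = insert (c + n - 1) {z i..<c + n - 1}"
        using zi zn i \<open>0 < n\<close> by auto
      then have "(\<Sum>y\<in>{z i..<z (Suc i)}. f r y) = f r (c + n - 1) + (P r (z i) - P r (c + n - 1))"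
        using sumP[OF zi] by simp
      also have "f r (c + n - 1) = (P r (c + n - 1) - P r (c + n)) / 2"
        using \<open>odd k\<close> k dP[of r "c + n - 1"] by (simp add: f_def w_def)
      \<comment> \<open>on the even line the heights \<open>c + n - 1\<close> and \<open>c + n\<close> have distances \<open>1/2\<close> and \<open>-1/2\<close>, so the weight 1/2 cancels the boundary terms\<close>
      also have "P r (c + n) = - P r (c + n - 1)"
      proof -
        have "real k = 2 * real n - 1" using k(1) by linarith
        then have "wall_dist c (Suc k) (c + n) = - wall_dist c (Suc k) (c + n - 1)"
          using \<open>0 < n\<close> by (simp add: wall_dist_def field_simps of_nat_diff)
        then show ?thesis using \<open>odd k\<close> by (simp add: P_def central_factorial_even_minus)
      qed
      finally show ?thesis using False by simp
    qed
    then have "fdet n (\<lambda>i r. \<Sum>y\<in>{z i..<z (Suc i)}. f r y)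
        = fdet n (\<lambda>i r. if Suc i < n then P r (z i) - P r (z (Suc i)) else P r (z i))"
      by (intro fdet_cong)
    also have "\<dots> = fdet n (\<lambda>i r. P r (z i))"
      by (rule fdet_row_diff_next)
    finally show ?thesis by (simp add: k(2) P_def)
  qed
  finally show ?case by (simp only: n'_def z_def)
qed

text \<open>Up to row and column factors the matrix of central factorials is a Newton matrix in the squared distances.\<close>
lemma weighted_count_product:
  assumes "T \<subseteq> {..<row_end c k}" "card T = c"
  defines "n \<equiv> Suc k div 2" and "\<epsilon> \<equiv> (if odd k then 0 else 1 :: nat)"
    and "d \<equiv> \<lambda>i. wall_dist c k (hole T i)"
  shows "weighted_count c k T
    = (\<Prod>i<n. d i ^ \<epsilon>) * (\<Prod>r<n. 1 / fact (2 * r + \<epsilon>)) * (\<Prod>j<n. \<Prod>i<j. (d i)\<^sup>2 - (d j)\<^sup>2)"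
proof -
  \<comment> \<open>the squared roots of the central factorials are the Newton nodes\<close>
  define s where "s l = (if odd k then real l else real l + 1 / 2)\<^sup>2" for l
  have "weighted_count c k T = fdet n (\<lambda>i r. d i ^ \<epsilon> * (1 / fact (2 * r + \<epsilon>)) * (\<Prod>l<r. s l - (d i)\<^sup>2))"
    unfolding weighted_count_eq_fdet[OF assms(1,2)] n_def d_def \<epsilon>_def s_def
    by (rule fdet_cong) (simp add: central_factorial_def)
  also have "\<dots> = (\<Prod>i<n. d i ^ \<epsilon>) * (\<Prod>r<n. 1 / fact (2 * r + \<epsilon>)) * fdet n (\<lambda>i r. \<Prod>l<r. s l - (d i)\<^sup>2)"
    by (rule fdet_scale_rows_cols)
  also have "fdet n (\<lambda>i r. \<Prod>l<r. s l - (d i)\<^sup>2) = (\<Prod>j<n. \<Prod>i<j. (d i)\<^sup>2 - (d j)\<^sup>2)"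
    by (rule fdet_vandermonde_newton)
  finally show ?thesis .
qed

section \<open>Evaluation at the last line\<close>

lemma fact_mult_prod_ascending:
  "fact m * (\<Prod>s<n. real m + 1 + real s) = fact (m + n)"
proof (induction n)
  case (Suc n)
  have "fact m * (\<Prod>s<Suc n. real m + 1 + real s) = fact (m + n) * (real m + 1 + real n)"
    unfolding Suc.IH[symmetric] by simp
  then show ?case by (simp add: algebra_simps)
qed simp

lemma prod_descending_eq_fact: "(\<Prod>s<n. real n - real s) = fact n"
proof -
  have "(\<Prod>s<n. real n - real s) = (\<Prod>s<n. real (Suc s))"
    by (subst prod.nat_diff_reindex[symmetric]) (auto intro!: prod.cong simp: of_nat_diff)
  then show ?thesis by (simp add: fact_prod_Suc lessThan_atLeast0)
qed

text \<open>Counting the holes from the wall instead of from below.\<close>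
lemma prod_pairs_reflect:
  fixes g :: "nat \<Rightarrow> nat \<Rightarrow> real"
  shows "(\<Prod>j<n. \<Prod>i<j. g i j) = (\<Prod>u<n. \<Prod>v<u. g (n - 1 - u) (n - 1 - v))"
  by (simp add: prod.Sigma)
     (rule prod.reindex_bij_witness[of _ "\<lambda>(u, v). (n - 1 - v, n - 1 - u)" "\<lambda>(j, i). (n - 1 - i, n - 1 - j)"],
      auto)

lemma prod_triangle_swap:
  fixes g :: "nat \<Rightarrow> nat \<Rightarrow> real"
  shows "(\<Prod>t<a. \<Prod>s\<in>{t..<a}. g t s) = (\<Prod>s<a. \<Prod>t<Suc s. g t s)"
  by (simp add: prod.Sigma del: prod.lessThan_Suc)
     (rule prod.reindex_bij_witness[of _ "\<lambda>(s, t). (t, s)" "\<lambda>(t, s). (s, t)"], auto)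

lemma prod_split_at:
  fixes g :: "nat \<Rightarrow> real"
  shows "(\<Prod>u<m + a. g u) = (\<Prod>u<m. g u) * (\<Prod>t<a. g (m + t))"
  by (induction a) (simp_all add: mult.assoc)

text \<open>Holes with no occupied height between them and the wall. Each contributes 1/2, the weight of one forced topmost
  hole, except the topmost hole of an odd line (\<open>u = 0\<close>), whose factor is 1.\<close>
lemma low_row_factor:
  assumes "\<epsilon> = 1 \<or> \<epsilon> = 0 \<and> 0 < u"
  defines "D \<equiv> \<lambda>u :: nat. real u + real \<epsilon> / 2"
  shows "D u ^ \<epsilon> * (\<Prod>v<u. (D u)\<^sup>2 - (D v)\<^sup>2) / fact (2 * u + \<epsilon>) = 1 / 2"
proof -
  have "(\<Prod>v<u. (D u)\<^sup>2 - (D v)\<^sup>2) = (\<Prod>v<u. (real u - real v) * (real u + real v + real \<epsilon>))"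
    by (rule prod.cong) (auto simp: D_def power2_eq_square field_simps)
  also have "\<dots> = fact u * (\<Prod>v<u. real u + real v + real \<epsilon>)"
    by (simp add: prod.distrib prod_descending_eq_fact)
  finally have *: "(\<Prod>v<u. (D u)\<^sup>2 - (D v)\<^sup>2) = fact u * (\<Prod>v<u. real u + real v + real \<epsilon>)" .
  show ?thesis
  proof (cases "\<epsilon> = 1")
    case True
    have "fact u * (\<Prod>v<u. real u + real v + real \<epsilon>) = fact (2 * u)"
      using fact_mult_prod_ascending[of u u] by (simp add: True mult_2 add_ac)
    then show ?thesis unfolding * by (simp add: True D_def divide_simps)
  next
    case False
    then have e: "\<epsilon> = 0" "0 < u" using assms by auto
    then obtain w where w: "u = Suc w" by (cases u) auto
    have "fact w * (\<Prod>v<u. real u + real v + real \<epsilon>) = fact (w + u)"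
      using fact_mult_prod_ascending[of w u] by (simp add: e w add_ac)
    then have "fact u * (\<Prod>v<u. real u + real v + real \<epsilon>) = real u * fact (w + u)"
      by (simp add: w del: prod.lessThan_Suc of_nat_Suc)
    moreover have "fact (2 * u + \<epsilon>) = real (2 * u) * fact (w + u)"
    proof -
      have "2 * u = Suc (w + u)" using w by simp
      then show ?thesis using e(1) by (simp only: fact_Suc add_0_right)
    qed
    ultimately show ?thesis using e(2) unfolding * by (simp add: e divide_simps)
  qed
qed

text \<open>A hole of the lower block is paired with the \<open>\<nu>\<close> holes at the wall, which yields the factors
  \<open>c + t + 1, \<dots>, c + t + \<beta>\<close> together with half of the factor for \<open>s = t\<close>, and with the holes above it in its own
  block, which yields the other factors with \<open>2 c\<close>. The parameter \<open>\<epsilon>\<close> is 1 on even and 0 on odd lines.\<close>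
lemma high_row_factor:
  fixes c :: nat
  assumes "\<epsilon> \<le> 1" and \<beta>: "Suc \<beta> = 2 * \<nu> + \<epsilon>"
  defines "D \<equiv> \<lambda>u :: nat. (if u < \<nu> then 0 else real c) + real u + real \<epsilon> / 2"
  shows "D (\<nu> + t) ^ \<epsilon> * (\<Prod>v<\<nu> + t. (D (\<nu> + t))\<^sup>2 - (D v)\<^sup>2) / fact (2 * (\<nu> + t) + \<epsilon>)
    = 1 / 2 * ((\<Prod>j<\<beta>. (real c + real t + 1 + real j) / (real t + 1 + real j))
        * (\<Prod>s<Suc t. (2 * real c + real \<beta> + real t + 1 + real s) / (real \<beta> + real t + 1 + real s)))"
proof -
  let ?x = "real c + real t + 1"
  have "real (Suc \<beta>) = real (2 * \<nu> + \<epsilon>)" by (simp only: \<beta>)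
  then have \<beta>_real: "real \<beta> = 2 * real \<nu> + real \<epsilon> - 1" by simp
  have low: "(\<Prod>v<\<nu>. (D (\<nu> + t))\<^sup>2 - (D v)\<^sup>2)
      = (\<Prod>j<\<nu>. ?x + real j) * (\<Prod>v<\<nu>. real c + real t + real \<nu> + real \<epsilon> + real v)"
  proof -
    have "(\<Prod>v<\<nu>. (D (\<nu> + t))\<^sup>2 - (D v)\<^sup>2)
        = (\<Prod>v<\<nu>. (real c + real t + (real \<nu> - real v)) * (real c + real t + real \<nu> + real \<epsilon> + real v))"
      by (rule prod.cong) (auto simp: D_def power2_eq_square field_simps)
    also have "\<dots> = (\<Prod>v<\<nu>. real c + real t + (real \<nu> - real v))
        * (\<Prod>v<\<nu>. real c + real t + real \<nu> + real \<epsilon> + real v)"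
      by (rule prod.distrib)
    also have "(\<Prod>v<\<nu>. real c + real t + (real \<nu> - real v)) = (\<Prod>j<\<nu>. ?x + real j)"
      by (subst prod.nat_diff_reindex[symmetric]) (auto intro!: prod.cong simp: of_nat_diff)
    finally show ?thesis .
  qed
  have mid: "D (\<nu> + t) ^ \<epsilon> * (\<Prod>v<\<nu>. (D (\<nu> + t))\<^sup>2 - (D v)\<^sup>2)
      = (\<Prod>j<\<beta>. ?x + real j) * (real c + real t + real \<nu> + real \<epsilon> / 2)"
  proof (cases "\<epsilon> = 1")
    case True
    then have b: "\<beta> = \<nu> + \<nu>" using \<beta> by simp
    show ?thesis unfolding low b prod_split_at by (simp add: True D_def add_ac)
  next
    case False
    then have e: "\<epsilon> = 0" using assms(1) by simp
    then obtain m where m: "\<nu> = Suc m" using \<beta> by (cases \<nu>) auto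
    have b: "\<beta> = \<nu> + m" using \<beta> e m by simp
    have "(\<Prod>v<\<nu>. real c + real t + real \<nu> + real \<epsilon> + real v)
        = (real c + real t + real \<nu>) * (\<Prod>j<m. ?x + real (\<nu> + j))"
      unfolding e m by (subst prod.lessThan_Suc_shift) (simp add: add_ac)
    then show ?thesis unfolding low b prod_split_at by (simp add: e add_ac)
  qed
  have high: "(\<Prod>s<t. (D (\<nu> + t))\<^sup>2 - (D (\<nu> + s))\<^sup>2)
      = fact t * (\<Prod>s<t. 2 * real c + real \<beta> + real t + 1 + real s)"
  proof -
    have "(\<Prod>s<t. (D (\<nu> + t))\<^sup>2 - (D (\<nu> + s))\<^sup>2)
        = (\<Prod>s<t. (real t - real s) * (2 * real c + real \<beta> + real t + 1 + real s))"
      unfolding \<beta>_real by (intro prod.cong) (auto simp: D_def power2_eq_square field_simps)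
    then show ?thesis by (simp add: prod.distrib prod_descending_eq_fact)
  qed
  have half: "real c + real t + real \<nu> + real \<epsilon> / 2 = 1 / 2 * (2 * real c + real \<beta> + real t + 1 + real t)"
    unfolding \<beta>_real by (simp add: field_simps)
  have fact: "fact (2 * (\<nu> + t) + \<epsilon>)
      = fact t * (\<Prod>j<\<beta>. real t + 1 + real j) * (\<Prod>s<Suc t. real \<beta> + real t + 1 + real s)"
  proof -
    have "2 * (\<nu> + t) + \<epsilon> = (\<beta> + t) + Suc t" using \<beta> by simp
    then have "fact (2 * (\<nu> + t) + \<epsilon>) = fact (\<beta> + t) * (\<Prod>s<Suc t. real (\<beta> + t) + 1 + real s)"
      by (simp only: fact_mult_prod_ascending)
    also have "fact (\<beta> + t) = fact t * (\<Prod>j<\<beta>. real t + 1 + real j)"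
      unfolding add.commute[of \<beta> t] by (rule fact_mult_prod_ascending[symmetric])
    finally show ?thesis by simp
  qed
  have numerator: "D (\<nu> + t) ^ \<epsilon> * (\<Prod>v<\<nu> + t. (D (\<nu> + t))\<^sup>2 - (D v)\<^sup>2)
      = 1 / 2 * fact t * (\<Prod>j<\<beta>. ?x + real j) * (\<Prod>s<Suc t. 2 * real c + real \<beta> + real t + 1 + real s)"
    unfolding prod_split_at mult.assoc[symmetric] mid high half by simp
  show ?thesis
    unfolding numerator fact prod_dividef by (simp del: prod.lessThan_Suc)
qed

text \<open>On the last line the heights \<open>0, \<dots>, a - 1\<close> and all heights from \<open>a + c\<close> on are holes. The power of 2 removes
  the weights of the topmost holes on the lines beyond \<open>2 a\<close>, which do not belong to marked positions.\<close>
lemma weighted_count_final: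
  assumes "a \<le> b"
  shows "2 ^ ((a + b) div 2 - a) * weighted_count c (a + b) {a..<a + c}
    = (\<Prod>t<a. 1 / 2 * ((\<Prod>j<b - a. (real c + real t + 1 + real j) / (real t + 1 + real j))
        * (\<Prod>s<Suc t. (2 * real c + real (b - a) + real t + 1 + real s) / (real (b - a) + real t + 1 + real s))))"
proof -
  define k where "k = a + b"
  define n where "n = Suc k div 2"
  define \<epsilon> where "\<epsilon> = (if odd k then 0 else 1 :: nat)"
  \<comment> \<open>the number of holes above the block of \<open>c\<close> occupied heights that remain below the wall\<close>
  define \<nu> where "\<nu> = n - a"
  define \<beta> where "\<beta> = b - a"
  define D where "D u = (if u < \<nu> then 0 else real c) + real u + real \<epsilon> / 2" for u :: nat
  let ?T = "{a..<a + c}"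
  have kn: "Suc k = 2 * n + \<epsilon>" by (auto simp: n_def \<epsilon>_def elim!: oddE evenE)
  have n: "n = \<nu> + a" using assms kn by (simp add: \<nu>_def k_def \<epsilon>_def split: if_splits)
  have \<beta>: "Suc \<beta> = 2 * \<nu> + \<epsilon>" using assms kn n by (simp add: k_def \<beta>_def)
  have hole: "hole ?T = (\<lambda>i. if i < a then i else c + i)"
  proof (rule hole_unique)
    have "y \<in> range (\<lambda>i. if i < a then i else c + i)" if "y \<in> - ?T" for y
      using that by (intro range_eqI[of _ _ "if y < a then y else y - c"]) auto
    moreover have "(if i < a then i else c + i) \<in> - ?T" for i by auto
    ultimately show "range (\<lambda>i. if i < a then i else c + i) = - ?T" by blast
  qed (auto intro!: strict_monoI)
  have d: "wall_dist c k (hole ?T (n - 1 - u)) = D u" if "u < n" for u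
  proof -
    have "real k + 1 = 2 * real n + real \<epsilon>" using kn by linarith
    then have k: "real k = 2 * real n + real \<epsilon> - 1" by simp
    have "n - 1 - u < a \<longleftrightarrow> \<not> u < \<nu>" using n that by auto
    then show ?thesis using that unfolding hole wall_dist_def D_def k
      by (simp add: of_nat_diff field_simps)
  qed
  have "weighted_count c k ?T
      = (\<Prod>i<n. wall_dist c k (hole ?T i) ^ \<epsilon>) * (\<Prod>r<n. 1 / fact (2 * r + \<epsilon>))
        * (\<Prod>j<n. \<Prod>i<j. (wall_dist c k (hole ?T i))\<^sup>2 - (wall_dist c k (hole ?T j))\<^sup>2)"
    unfolding n_def \<epsilon>_def
    by (rule weighted_count_product) (use assms in \<open>auto simp: row_end_def k_def\<close>)
  also have "(\<Prod>i<n. wall_dist c k (hole ?T i) ^ \<epsilon>) = (\<Prod>u<n. D u ^ \<epsilon>)"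
    by (subst prod.nat_diff_reindex[symmetric]) (auto intro!: prod.cong simp: d[simplified])
  also have "(\<Prod>j<n. \<Prod>i<j. (wall_dist c k (hole ?T i))\<^sup>2 - (wall_dist c k (hole ?T j))\<^sup>2)
      = (\<Prod>u<n. \<Prod>v<u. (D u)\<^sup>2 - (D v)\<^sup>2)"
    by (subst prod_pairs_reflect) (auto intro!: prod.cong simp: d[simplified])
  finally have "weighted_count c k ?T = (\<Prod>u<n. D u ^ \<epsilon> * (\<Prod>v<u. (D u)\<^sup>2 - (D v)\<^sup>2) / fact (2 * u + \<epsilon>))"
    by (simp add: prod_dividef prod.distrib)
  also have "\<dots> = (\<Prod>u<\<nu>. D u ^ \<epsilon> * (\<Prod>v<u. (D u)\<^sup>2 - (D v)\<^sup>2) / fact (2 * u + \<epsilon>))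
      * (\<Prod>t<a. D (\<nu> + t) ^ \<epsilon> * (\<Prod>v<\<nu> + t. (D (\<nu> + t))\<^sup>2 - (D v)\<^sup>2) / fact (2 * (\<nu> + t) + \<epsilon>))"
    unfolding n by (rule prod_split_at)
  also have "(\<Prod>u<\<nu>. D u ^ \<epsilon> * (\<Prod>v<u. (D u)\<^sup>2 - (D v)\<^sup>2) / fact (2 * u + \<epsilon>)) = (1 / 2) ^ (k div 2 - a)"
  proof -
    have D: "D u = real u + real \<epsilon> / 2" if "u < \<nu>" for u using that by (simp add: D_def)
    have row: "D u ^ \<epsilon> * (\<Prod>v<u. (D u)\<^sup>2 - (D v)\<^sup>2) / fact (2 * u + \<epsilon>) = 1 / 2"
      if "\<epsilon> = 1 \<or> \<epsilon> = 0 \<and> 0 < u" "u < \<nu>" for u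
      using low_row_factor[OF that(1)] that(2) by (simp add: D)
    show ?thesis
    proof (cases "\<epsilon> = 1")
      case True
      then have "k div 2 - a = \<nu>" using kn n by simp
      moreover have "(\<Prod>u<\<nu>. D u ^ \<epsilon> * (\<Prod>v<u. (D u)\<^sup>2 - (D v)\<^sup>2) / fact (2 * u + \<epsilon>)) = (\<Prod>u<\<nu>. 1 / 2)"
        by (rule prod.cong[OF refl], rule row) (simp_all add: True)
      ultimately show ?thesis by simp
    next
      case False
      then have e: "\<epsilon> = 0" by (simp add: \<epsilon>_def split: if_splits)
      then obtain m where m: "\<nu> = Suc m" using \<beta> by (cases \<nu>) auto
      then have "k div 2 - a = m" using kn n e by simp
      moreover have "(\<Prod>u<m. D (Suc u) ^ \<epsilon> * (\<Prod>v<Suc u. (D (Suc u))\<^sup>2 - (D v)\<^sup>2) / fact (2 * Suc u + \<epsilon>))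
          = (\<Prod>u<m. 1 / 2)"
        by (rule prod.cong[OF refl], rule row) (simp_all add: e m)
      ultimately show ?thesis unfolding m
        by (subst prod.lessThan_Suc_shift) (simp add: e del: prod.lessThan_Suc fact_Suc mult_Suc_right)
    qed
  qed
  also have "(\<Prod>t<a. D (\<nu> + t) ^ \<epsilon> * (\<Prod>v<\<nu> + t. (D (\<nu> + t))\<^sup>2 - (D v)\<^sup>2) / fact (2 * (\<nu> + t) + \<epsilon>))
      = (\<Prod>t<a. 1 / 2 * ((\<Prod>j<\<beta>. (real c + real t + 1 + real j) / (real t + 1 + real j))
        * (\<Prod>s<Suc t. (2 * real c + real \<beta> + real t + 1 + real s) / (real \<beta> + real t + 1 + real s))))"
    unfolding D_def by (intro prod.cong refl high_row_factor[OF _ \<beta>]) (simp add: \<epsilon>_def)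
  finally show ?thesis
    unfolding k_def \<beta>_def by (simp add: power_one_over del: prod.lessThan_Suc)
qed

text \<open>The second product runs over pairs \<open>i \<le> j\<close> of a triangle; here it is arranged by the larger index.\<close>
lemma target_eq_row_product:
  assumes "a \<le> b"
  shows "1 / 2 ^ a * (\<Prod>i = 1..a.
       (\<Prod>j = 1..b - a. (real c + real i + real j - 1) / (real i + real j - 1)) *
       (\<Prod>j = b - a + i..b. (2 * real c + real i + real j - 1) / (real i + real j - 1)))
    = (\<Prod>t<a. 1 / 2 * ((\<Prod>j<b - a. (real c + real t + 1 + real j) / (real t + 1 + real j))
        * (\<Prod>s<Suc t. (2 * real c + real (b - a) + real t + 1 + real s) / (real (b - a) + real t + 1 + real s))))"
proof -
  define \<beta> where "\<beta> = b - a"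
  have b: "b = \<beta> + a" using assms by (simp add: \<beta>_def)
  have "(\<Prod>i = 1..a. (\<Prod>j = 1..\<beta>. (real c + real i + real j - 1) / (real i + real j - 1)) *
       (\<Prod>j = \<beta> + i..b. (2 * real c + real i + real j - 1) / (real i + real j - 1)))
     = (\<Prod>t<a. (\<Prod>j<\<beta>. (real c + real t + 1 + real j) / (real t + 1 + real j)) *
        (\<Prod>s\<in>{t..<a}. (2 * real c + real \<beta> + real s + 1 + real t) / (real \<beta> + real s + 1 + real t)))"
    (is "(\<Prod>i = 1..a. ?G i) = (\<Prod>t<a. ?R t)")
  proof -
    have "?G (Suc t) = ?R t" for t
    proof -
      have "(\<Prod>j = 1..\<beta>. (real c + real (Suc t) + real j - 1) / (real (Suc t) + real j - 1))
          = (\<Prod>j<\<beta>. (real c + real t + 1 + real j) / (real t + 1 + real j))"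
        by (rule prod.reindex_bij_witness[of _ Suc "\<lambda>i. i - 1"]) (auto simp: add_ac of_nat_diff)
      moreover have "(\<Prod>j = \<beta> + Suc t..b. (2 * real c + real (Suc t) + real j - 1) / (real (Suc t) + real j - 1))
          = (\<Prod>s\<in>{t..<a}. (2 * real c + real \<beta> + real s + 1 + real t) / (real \<beta> + real s + 1 + real t))"
        by (rule prod.reindex_bij_witness[of _ "\<lambda>s. \<beta> + Suc s" "\<lambda>j. j - Suc \<beta>"]) (auto simp: add_ac of_nat_diff b)
      ultimately show ?thesis by simp
    qed
    then show ?thesis
      using prod.atLeast1_atMost_eq[of ?G a] by simp
  qed
  also have "\<dots> = (\<Prod>t<a. (\<Prod>j<\<beta>. (real c + real t + 1 + real j) / (real t + 1 + real j)) *
        (\<Prod>s<Suc t. (2 * real c + real \<beta> + real t + 1 + real s) / (real \<beta> + real t + 1 + real s)))"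
    unfolding prod.distrib
    by (subst prod_triangle_swap) (rule refl)
  finally show ?thesis
    unfolding \<beta>_def[symmetric] prod.distrib[of "\<lambda>_. 1 / 2"]
    by (simp add: power_one_over del: prod.lessThan_Suc)
qed

section \<open>Matchings as sequences of position sets\<close>

text \<open>The upward triangles that share an edge with the downward triangle to the right of edge \<open>(k, j)\<close>; the pair
  \<open>(k, j)\<close> also names the upward triangle to the left of this edge.\<close>
definition nbrs :: "nat \<times> nat \<Rightarrow> (nat \<times> nat) set" where
  "nbrs = (\<lambda>(k, j). {(k, j), (Suc k, j), (Suc k, Suc j)})"

text \<open>The downward triangles lie to the right of lines \<open>0, \<dots>, K - 1\<close>, the upward ones to the left of lines
  \<open>1, \<dots>, K\<close>.\<close>
definition matchings :: "nat \<Rightarrow> (nat \<Rightarrow> nat set) \<Rightarrow> (nat \<times> nat \<Rightarrow> nat \<times> nat) set" where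
  "matchings K J = {\<sigma> \<in> extensional (Sigma {..<K} J).
     bij_betw \<sigma> (Sigma {..<K} J) (Sigma {1..K} J) \<and> (\<forall>d\<in>Sigma {..<K} J. \<sigma> d \<in> nbrs d)}"

definition line_sequences :: "nat \<Rightarrow> (nat \<Rightarrow> nat set) \<Rightarrow> (nat \<Rightarrow> nat set) set" where
  "line_sequences K J = {S \<in> extensional {..K}. S 0 = J 0 \<and> S K = J K \<and>
     (\<forall>k\<le>K. S k \<subseteq> J k) \<and> (\<forall>k<K. step (S k) (S (Suc k)))}"

text \<open>The edges that are not the diagonal of a lozenge. All edges of line \<open>K\<close> belong to the boundary.\<close>
definition moving_edges :: "nat \<Rightarrow> (nat \<Rightarrow> nat set) \<Rightarrow> (nat \<times> nat \<Rightarrow> nat \<times> nat) \<Rightarrow> nat \<Rightarrow> nat set" where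
  "moving_edges K J \<sigma> = (\<lambda>k\<in>{..K}. {j \<in> J k. k = K \<or> \<sigma> (k, j) \<noteq> (k, j)})"

text \<open>At the least element where two such bijections differ, one of them fixes \<open>s\<close>. The other one then must reach
  \<open>s\<close> from \<open>s - 1\<close>, where both agree.\<close>
lemma step_bij_unique:
  assumes \<beta>: "bij_betw \<beta> S T" "\<And>s. s \<in> S \<Longrightarrow> \<beta> s = s \<or> \<beta> s = Suc s"
    and \<gamma>: "bij_betw \<gamma> S T" "\<And>s. s \<in> S \<Longrightarrow> \<gamma> s = s \<or> \<gamma> s = Suc s"
    and "s \<in> S"
  shows "\<beta> s = \<gamma> s"
  using \<open>s \<in> S\<close>
proof (induction s rule: less_induct)
  case (less s)
  have *: False
    if \<beta>: "bij_betw \<beta> S T" "\<And>s. s \<in> S \<Longrightarrow> \<beta> s = s \<or> \<beta> s = Suc s"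
      and \<gamma>: "bij_betw \<gamma> S T" "\<And>s. s \<in> S \<Longrightarrow> \<gamma> s = s \<or> \<gamma> s = Suc s"
      and eq: "\<And>r. r < s \<Longrightarrow> r \<in> S \<Longrightarrow> \<beta> r = \<gamma> r"
      and s: "\<beta> s = s" "\<gamma> s = Suc s" for \<beta> \<gamma> :: "nat \<Rightarrow> nat"
  proof -
    have "s \<in> T" using \<beta>(1) s(1) less.prems by (metis bij_betwE)
    then obtain r where r: "r \<in> S" "\<gamma> r = s" using \<gamma>(1) by (auto simp: bij_betw_def)
    then have "r \<noteq> s" using s(2) by auto
    then have "r < s" using \<gamma>(2)[OF r(1)] r(2) by auto
    then have "\<beta> r = \<beta> s" using eq r s by simp
    then show False using \<beta>(1) r(1) less.prems \<open>r \<noteq> s\<close> by (auto simp: bij_betw_def inj_on_def)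
  qed
  show ?case
  proof (rule ccontr)
    assume ne: "\<beta> s \<noteq> \<gamma> s"
    have "(\<beta> s = s \<and> \<gamma> s = Suc s) \<or> (\<gamma> s = s \<and> \<beta> s = Suc s)"
      using \<beta>(2)[OF less.prems] \<gamma>(2)[OF less.prems] ne by auto
    then show False
    proof
      assume "\<beta> s = s \<and> \<gamma> s = Suc s"
      then show False using *[of \<beta> \<gamma>] \<beta> \<gamma> less.IH by blast
    next
      assume "\<gamma> s = s \<and> \<beta> s = Suc s"
      then show False using *[of \<gamma> \<beta>] \<beta> \<gamma> less.IH[symmetric] by blast
    qed
  qed
qed

lemma matching_move:
  assumes "\<sigma> \<in> matchings K J" "k < K" "j \<in> moving_edges K J \<sigma> k"
  shows "\<sigma> (k, j) = (Suc k, snd (\<sigma> (k, j)))" "snd (\<sigma> (k, j)) = j \<or> snd (\<sigma> (k, j)) = Suc j"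
proof -
  have "(k, j) \<in> Sigma {..<K} J" "\<sigma> (k, j) \<noteq> (k, j)"
    using assms(2,3) by (auto simp: moving_edges_def)
  moreover from this have "\<sigma> (k, j) \<in> nbrs (k, j)"
    using assms(1) unfolding matchings_def by blast
  ultimately have "\<sigma> (k, j) = (Suc k, j) \<or> \<sigma> (k, j) = (Suc k, Suc j)"
    by (auto simp: nbrs_def)
  then show "\<sigma> (k, j) = (Suc k, snd (\<sigma> (k, j)))" "snd (\<sigma> (k, j)) = j \<or> snd (\<sigma> (k, j)) = Suc j"
    by auto
qed

lemma matching_step_bij:
  assumes \<sigma>: "\<sigma> \<in> matchings K J" and k: "k < K"
  shows "bij_betw (\<lambda>j. snd (\<sigma> (k, j))) (moving_edges K J \<sigma> k) (moving_edges K J \<sigma> (Suc k))"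
proof -
  have bij: "bij_betw \<sigma> (Sigma {..<K} J) (Sigma {1..K} J)"
    and nb: "\<And>d. d \<in> Sigma {..<K} J \<Longrightarrow> \<sigma> d \<in> nbrs d"
    using \<sigma> by (auto simp: matchings_def)
  have inj: "d = d'" if "\<sigma> d = \<sigma> d'" "d \<in> Sigma {..<K} J" "d' \<in> Sigma {..<K} J" for d d'
    using that bij by (auto simp: bij_betw_def inj_on_def)
  show ?thesis
  proof (rule bij_betw_imageI)
    show "inj_on (\<lambda>j. snd (\<sigma> (k, j))) (moving_edges K J \<sigma> k)"
    proof (rule inj_onI)
      fix j j' assume j: "j \<in> moving_edges K J \<sigma> k" "j' \<in> moving_edges K J \<sigma> k"
        and "snd (\<sigma> (k, j)) = snd (\<sigma> (k, j'))"
      then have "\<sigma> (k, j) = \<sigma> (k, j')"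
        using matching_move(1)[OF \<sigma> k] by metis
      then show "j = j'" using inj[of "(k, j)" "(k, j')"] j k by (auto simp: moving_edges_def)
    qed
    show "(\<lambda>j. snd (\<sigma> (k, j))) ` moving_edges K J \<sigma> k = moving_edges K J \<sigma> (Suc k)"
    proof (intro equalityI subsetI)
      fix y assume "y \<in> (\<lambda>j. snd (\<sigma> (k, j))) ` moving_edges K J \<sigma> k"
      then obtain j where j: "j \<in> moving_edges K J \<sigma> k" "y = snd (\<sigma> (k, j))" by auto
      then have eq: "\<sigma> (k, j) = (Suc k, y)" using matching_move(1)[OF \<sigma> k] by simp
      have d: "(k, j) \<in> Sigma {..<K} J" using j k by (auto simp: moving_edges_def)
      then have "(Suc k, y) \<in> Sigma {1..K} J" using eq bij by (metis bij_betwE)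
      moreover have "\<sigma> (Suc k, y) \<noteq> (Suc k, y)" if "Suc k < K"
      proof
        assume "\<sigma> (Suc k, y) = (Suc k, y)"
        then have "(k, j) = (Suc k, y)" using inj[of "(k, j)" "(Suc k, y)"] eq d that
            \<open>(Suc k, y) \<in> Sigma {1..K} J\<close> by simp
        then show False by simp
      qed
      ultimately show "y \<in> moving_edges K J \<sigma> (Suc k)"
        using k by (auto simp: moving_edges_def le_less)
    next
      fix y assume y: "y \<in> moving_edges K J \<sigma> (Suc k)"
      then have "(Suc k, y) \<in> Sigma {1..K} J" using k by (auto simp: moving_edges_def)
      then obtain d where d: "d \<in> Sigma {..<K} J" "\<sigma> d = (Suc k, y)"
        using bij_betw_imp_surj_on[OF bij] by (metis imageE)
      obtain i j where ij: "d = (i, j)" by (cases d)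
      have "(Suc k, y) \<in> nbrs (i, j)" using nb[OF d(1)] d(2) ij by simp
      moreover have "(i, j) \<noteq> (Suc k, y)" using y d ij by (auto simp: moving_edges_def split: if_splits)
      ultimately have "i = k" by (auto simp: nbrs_def)
      then have "j \<in> moving_edges K J \<sigma> k" using d ij by (auto simp: moving_edges_def)
      then show "y \<in> (\<lambda>j. snd (\<sigma> (k, j))) ` moving_edges K J \<sigma> k"
        using d ij \<open>i = k\<close> by force
    qed
  qed
qed

text \<open>A matching restricts to a step in each strip; conversely the steps and the holes together prescribe the
  partner of each downward triangle. Injectivity is the uniqueness of the bijection in a step.\<close>
lemma bij_betw_matchings_line_sequences:
  "bij_betw (moving_edges K J) (matchings K J) (line_sequences K J)"
proof (rule bij_betwI')
  fix \<sigma> \<tau> assume \<sigma>: "\<sigma> \<in> matchings K J" and \<tau>: "\<tau> \<in> matchings K J"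
  show "(moving_edges K J \<sigma> = moving_edges K J \<tau>) = (\<sigma> = \<tau>)"
  proof
    assume eq: "moving_edges K J \<sigma> = moving_edges K J \<tau>"
    show "\<sigma> = \<tau>"
    proof (rule extensionalityI)
      show "\<sigma> \<in> extensional (Sigma {..<K} J)" "\<tau> \<in> extensional (Sigma {..<K} J)"
        using \<sigma> \<tau> by (auto simp: matchings_def)
      fix d assume d: "d \<in> Sigma {..<K} J"
      obtain k j where kj: "d = (k, j)" by (cases d)
      have k: "k < K" "j \<in> J k" using d kj by auto
      show "\<sigma> d = \<tau> d"
      proof (cases "j \<in> moving_edges K J \<sigma> k")
        case True
        have "snd (\<sigma> (k, j)) = snd (\<tau> (k, j))"
        proof (rule step_bij_unique[where \<beta> = "\<lambda>j. snd (\<sigma> (k, j))" and \<gamma> = "\<lambda>j. snd (\<tau> (k, j))"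
              and S = "moving_edges K J \<sigma> k" and T = "moving_edges K J \<sigma> (Suc k)"])
          show "bij_betw (\<lambda>j. snd (\<sigma> (k, j))) (moving_edges K J \<sigma> k) (moving_edges K J \<sigma> (Suc k))"
            by (rule matching_step_bij[OF \<sigma> k(1)])
          show "bij_betw (\<lambda>j. snd (\<tau> (k, j))) (moving_edges K J \<sigma> k) (moving_edges K J \<sigma> (Suc k))"
            unfolding eq by (rule matching_step_bij[OF \<tau> k(1)])
        qed (use True matching_move(2)[OF \<sigma> k(1)] matching_move(2)[OF \<tau> k(1)] eq in auto)
        then show ?thesis
          using matching_move(1)[OF \<sigma> k(1) True] matching_move(1)[OF \<tau> k(1) True[unfolded eq]] kj by simp
      next
        case False
        moreover from this have "j \<notin> moving_edges K J \<tau> k" using eq by simp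
        ultimately show ?thesis using k kj by (auto simp: moving_edges_def)
      qed
    qed
  qed simp
next
  fix \<sigma> assume \<sigma>: "\<sigma> \<in> matchings K J"
  have "moving_edges K J \<sigma> 0 = J 0"
  proof -
    have "\<sigma> (0, j) \<noteq> (0, j)" if "j \<in> J 0" "0 < K" for j
    proof -
      have "(0, j) \<in> Sigma {..<K} J" using that by auto
      then have "\<sigma> (0, j) \<in> Sigma {1..K} J" using \<sigma> unfolding matchings_def by (auto dest: bij_betwE)
      then show ?thesis by auto
    qed
    then show ?thesis by (auto simp: moving_edges_def)
  qed
  moreover have "step (moving_edges K J \<sigma> k) (moving_edges K J \<sigma> (Suc k))" if "k < K" for k
    unfolding step_def using matching_step_bij[OF \<sigma> that] matching_move(2)[OF \<sigma> that] by blast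
  ultimately show "moving_edges K J \<sigma> \<in> line_sequences K J"
    by (auto simp: line_sequences_def moving_edges_def)
next
  fix S assume S: "S \<in> line_sequences K J"
  then have "\<forall>k\<in>{..<K}. \<exists>\<beta>. bij_betw \<beta> (S k) (S (Suc k)) \<and> (\<forall>s\<in>S k. \<beta> s = s \<or> \<beta> s = Suc s)"
    by (auto simp: line_sequences_def step_def)
  then obtain \<beta> where \<beta>: "\<And>k. k < K \<Longrightarrow> bij_betw (\<beta> k) (S k) (S (Suc k))"
    and \<beta>_move: "\<And>k s. k < K \<Longrightarrow> s \<in> S k \<Longrightarrow> \<beta> k s = s \<or> \<beta> k s = Suc s"
    unfolding bchoice_iff by auto
  have SJ: "S k \<subseteq> J k" if "k \<le> K" for k using S that by (auto simp: line_sequences_def)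
  have ends: "S 0 = J 0" "S K = J K" using S by (auto simp: line_sequences_def)
  define \<sigma> where "\<sigma> = (\<lambda>(k, j)\<in>Sigma {..<K} J. if j \<in> S k then (Suc k, \<beta> k j) else (k, j))"
  have \<sigma>: "\<sigma> (k, j) = (if j \<in> S k then (Suc k, \<beta> k j) else (k, j))" if "k < K" "j \<in> J k" for k j
    using that by (simp add: \<sigma>_def)
  have \<beta>S: "\<beta> k j \<in> S (Suc k)" if "k < K" "j \<in> S k" for k j using \<beta>[OF that(1)] that(2) by (rule bij_betwE[rule_format])
  have "bij_betw \<sigma> (Sigma {..<K} J) (Sigma {1..K} J)"
  proof (rule bij_betw_imageI)
    show "inj_on \<sigma> (Sigma {..<K} J)"
    proof (rule inj_onI)
      fix d d' assume d: "d \<in> Sigma {..<K} J" "d' \<in> Sigma {..<K} J" and eq: "\<sigma> d = \<sigma> d'"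
      obtain k j k' j' where kj: "d = (k, j)" "d' = (k', j')" by (cases d, cases d')
      have k: "k < K" "j \<in> J k" "k' < K" "j' \<in> J k'" using d kj by auto
      have eq: "(if j \<in> S k then (Suc k, \<beta> k j) else (k, j)) = (if j' \<in> S k' then (Suc k', \<beta> k' j') else (k', j'))"
        using eq unfolding kj \<sigma>[OF k(1,2)] \<sigma>[OF k(3,4)] .
      show "d = d'"
      proof (cases "j \<in> S k"; cases "j' \<in> S k'")
        assume "j \<in> S k" "j' \<in> S k'"
        then show ?thesis using eq kj \<beta>[OF k(1)] by (auto simp: bij_betw_def inj_on_def)
      next
        assume "j \<in> S k" "j' \<notin> S k'"
        then show ?thesis using eq \<beta>S[OF k(1), of j] by auto
      next
        assume "j \<notin> S k" "j' \<in> S k'"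
        then show ?thesis using eq \<beta>S[OF k(3), of j'] by auto
      next
        assume "j \<notin> S k" "j' \<notin> S k'"
        then show ?thesis using eq kj by auto
      qed
    qed
    show "\<sigma> ` Sigma {..<K} J = Sigma {1..K} J"
    proof (intro equalityI subsetI)
      fix u assume "u \<in> \<sigma> ` Sigma {..<K} J"
      then obtain k j where k: "k < K" "j \<in> J k" "u = \<sigma> (k, j)" by auto
      show "u \<in> Sigma {1..K} J"
      proof (cases "j \<in> S k")
        case True
        then show ?thesis using k \<sigma>[OF k(1,2)] \<beta>S[OF k(1) True] SJ[of "Suc k"] by auto
      next
        case False
        then have "k \<noteq> 0" using k(2) ends(1) by metis
        then show ?thesis using False k \<sigma>[OF k(1,2)] by auto
      qed
    next
      fix u assume "u \<in> Sigma {1..K} J"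
      then obtain k j where k: "1 \<le> k" "k \<le> K" "j \<in> J k" "u = (k, j)" by auto
      show "u \<in> \<sigma> ` Sigma {..<K} J"
      proof (cases "j \<in> S k")
        case True
        obtain m where m: "k = Suc m" using k(1) by (cases k) auto
        then have "m < K" using k by simp
        then obtain i where i: "i \<in> S m" "\<beta> m i = j"
          using bij_betw_imp_surj_on[OF \<beta>[of m]] True m by (metis imageE)
        then have "i \<in> J m" using SJ[of m] \<open>m < K\<close> by auto
        then have "\<sigma> (m, i) = u" using \<sigma>[OF \<open>m < K\<close>] i k m by simp
        then show ?thesis using \<open>m < K\<close> \<open>i \<in> J m\<close> by force
      next
        case False
        then have "k < K" using k(2,3) ends(2) by (metis le_neq_implies_less)
        then have "\<sigma> (k, j) = u" using \<sigma> k False by simp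
        then show ?thesis using k \<open>k < K\<close> by force
      qed
    qed
  qed
  moreover have "\<sigma> d \<in> nbrs d" if d: "d \<in> Sigma {..<K} J" for d
  proof -
    obtain k j where kj: "d = (k, j)" "k < K" "j \<in> J k" using d by auto
    then show ?thesis using \<sigma>[of k j] \<beta>_move[of k j] by (auto simp: nbrs_def)
  qed
  moreover have "\<sigma> \<in> extensional (Sigma {..<K} J)" unfolding \<sigma>_def by simp
  ultimately have "\<sigma> \<in> matchings K J" by (simp add: matchings_def)
  moreover have "S = moving_edges K J \<sigma>"
  proof (rule extensionalityI)
    show "S \<in> extensional {..K}" using S by (simp add: line_sequences_def)
    show "moving_edges K J \<sigma> \<in> extensional {..K}" by (simp add: moving_edges_def)
    fix k assume "k \<in> {..K}"
    show "S k = moving_edges K J \<sigma> k"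
    proof (cases "k = K")
      case True
      then show ?thesis using ends by (simp add: moving_edges_def)
    next
      case False
      then have k: "k < K" using \<open>k \<in> {..K}\<close> by simp
      have "\<sigma> (k, j) \<noteq> (k, j) \<longleftrightarrow> j \<in> S k" if "j \<in> J k" for j
        using \<sigma>[OF k that] by simp
      then have "moving_edges K J \<sigma> k = {j \<in> J k. j \<in> S k}"
        using k by (auto simp: moving_edges_def)
      moreover have "S k \<subseteq> J k" using SJ k by simp
      ultimately show ?thesis by blast
    qed
  qed
  ultimately show "\<exists>\<sigma>\<in>matchings K J. S = moving_edges K J \<sigma>" by blast
qed

definition sequences_to :: "nat \<Rightarrow> nat \<Rightarrow> nat set \<Rightarrow> (nat \<Rightarrow> nat set) set" where
  "sequences_to c k T = {S \<in> extensional {..k}. S 0 = {..<c} \<and> S k = T \<and>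
     (\<forall>i<k. S i \<subseteq> {..<row_end c i}) \<and> (\<forall>i<k. step (S i) (S (Suc i)))}"

lemma finite_sequences_to: "finite (sequences_to c k T)"
proof (rule finite_subset)
  show "sequences_to c k T \<subseteq> (\<Pi>\<^sub>E i\<in>{..k}. insert T (Pow {..<row_end c i}))"
  proof (rule subsetI, rule PiE_I)
    fix S i assume S: "S \<in> sequences_to c k T" and "i \<in> {..k}"
    then show "S i \<in> insert T (Pow {..<row_end c i})"
      by (cases "i = k") (simp_all add: sequences_to_def)
  qed (simp add: sequences_to_def extensional_def)
  show "finite (\<Pi>\<^sub>E i\<in>{..k}. insert T (Pow {..<row_end c i}))"
    by (intro finite_PiE) auto
qed

lemma sum_sequences_to:
  "(\<Sum>S\<in>sequences_to c k T. \<Prod>i<k. wall_weight c i (S i)) = weighted_count c k T"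
proof (induction k arbitrary: T)
  case 0
  have "sequences_to c 0 T = (if T = {..<c} then {\<lambda>i\<in>{..0}. T} else {})"
    by (auto simp: sequences_to_def extensional_def fun_eq_iff restrict_def)
  then show ?case by simp
next
  case (Suc k)
  let ?A = "{S. S \<subseteq> {..<row_end c k} \<and> step S T}"
  let ?f = "\<lambda>(R, S). S(Suc k := T)"
  have "(\<Sum>S\<in>sequences_to c (Suc k) T. \<Prod>i<Suc k. wall_weight c i (S i))
      = (\<Sum>(R, S)\<in>Sigma ?A (sequences_to c k). wall_weight c k R * (\<Prod>i<k. wall_weight c i (S i)))"
  proof (rule sum.reindex_bij_witness[symmetric, of _ "\<lambda>S. (S k, restrict S {..k})" ?f])
    fix p assume "p \<in> Sigma ?A (sequences_to c k)"
    then obtain R S where p: "p = (R, S)" and R: "R \<subseteq> {..<row_end c k}" "step R T"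
      and S: "S \<in> sequences_to c k R" by auto
    have "restrict (S(Suc k := T)) {..k} = S"
      using S by (auto simp: sequences_to_def extensional_def fun_eq_iff restrict_def)
    moreover have "S k = R" using S by (simp add: sequences_to_def)
    ultimately show "(\<lambda>S. (S k, restrict S {..k})) (?f p) = p" using p by simp
    have "(S(Suc k := T)) i \<subseteq> {..<row_end c i}" "step ((S(Suc k := T)) i) ((S(Suc k := T)) (Suc i))"
      if "i < Suc k" for i
      using that R S by (auto simp: sequences_to_def less_Suc_eq)
    then show "?f p \<in> sequences_to c (Suc k) T"
      using S by (auto simp: p sequences_to_def extensional_def)
    show "(\<Prod>i<Suc k. wall_weight c i (?f p i)) = (case p of (R, S) \<Rightarrow> wall_weight c k R * (\<Prod>i<k. wall_weight c i (S i)))"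
      using \<open>S k = R\<close> by (simp add: p)
  next
    fix S assume S: "S \<in> sequences_to c (Suc k) T"
    show "?f ((\<lambda>S. (S k, restrict S {..k})) S) = S"
      using S by (auto simp: sequences_to_def extensional_def fun_eq_iff restrict_def)
    show "(S k, restrict S {..k}) \<in> Sigma ?A (sequences_to c k)"
      using S by (auto simp: sequences_to_def less_Suc_eq)
  qed
  also have "\<dots> = (\<Sum>R\<in>?A. \<Sum>S\<in>sequences_to c k R. wall_weight c k R * (\<Prod>i<k. wall_weight c i (S i)))"
  proof (rule sum.Sigma[symmetric])
    show "finite ?A" by (rule finite_subset[of _ "Pow {..<row_end c k}"]) auto
  qed (simp add: finite_sequences_to)
  also have "\<dots> = (\<Sum>R\<in>?A. wall_weight c k R * weighted_count c k R)"
    by (simp add: Suc.IH flip: sum_distrib_left)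
  finally show ?case by simp
qed

text \<open>The heights on line \<open>k\<close> that belong to the region: the three conditions are the southeastern side, the northern
  side and the zigzag cut.\<close>
definition H1_line :: "nat \<Rightarrow> nat \<Rightarrow> nat \<Rightarrow> nat \<Rightarrow> nat set" where
  "H1_line a b c k = {j. k \<le> j + b \<and> j < a + c \<and> 2 * j < k + 2 * c}"

lemma less_row_end_iff: "j < row_end c k \<longleftrightarrow> 2 * j < k + 2 * c"
  unfolding row_end_def by linarith

lemma H1_line_first: "H1_line a b c 0 = {..<c}"
  by (auto simp: H1_line_def)

lemma H1_line_last: "a \<le> b \<Longrightarrow> H1_line a b c (a + b) = {a..<a + c}"
  by (auto simp: H1_line_def)

text \<open>The southeastern and northern sides are implied by the last set, since no step lowers an element or raises it
  by more than one.\<close>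
lemma line_sequences_H1_line:
  assumes "a \<le> b"
  shows "line_sequences (a + b) (H1_line a b c) = sequences_to c (a + b) {a..<a + c}"
proof (intro equalityI subsetI)
  fix S assume "S \<in> line_sequences (a + b) (H1_line a b c)"
  then have S: "S \<in> extensional {..a + b}" "S 0 = {..<c}" "S (a + b) = {a..<a + c}"
      "\<And>k. k \<le> a + b \<Longrightarrow> S k \<subseteq> H1_line a b c k" "\<And>k. k < a + b \<Longrightarrow> step (S k) (S (Suc k))"
    by (simp_all add: line_sequences_def H1_line_first H1_line_last[OF assms])
  have "H1_line a b c k \<subseteq> {..<row_end c k}" for k
    by (auto simp: H1_line_def less_row_end_iff)
  then have "S k \<subseteq> {..<row_end c k}" if "k < a + b" for k
    using S(4)[of k] that by (meson less_imp_le order_trans)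
  then show "S \<in> sequences_to c (a + b) {a..<a + c}"
    using S by (simp add: sequences_to_def)
next
  fix S assume S: "S \<in> sequences_to c (a + b) {a..<a + c}"
  let ?K = "a + b"
  have below: "\<forall>j\<in>S k. j < a + c \<and> k \<le> j + b" if "k \<le> ?K" for k
    using that
  proof (induction rule: inc_induct)
    case base
    show ?case using S by (auto simp: sequences_to_def)
  next
    case (step n)
    have "step (S n) (S (Suc n))" using S step.hyps by (simp add: sequences_to_def)
    then obtain \<beta> where \<beta>: "bij_betw \<beta> (S n) (S (Suc n))" "\<And>s. s \<in> S n \<Longrightarrow> \<beta> s = s \<or> \<beta> s = Suc s"
      by (auto simp: step_def)
    have "s < a + c \<and> n \<le> s + b" if "s \<in> S n" for s
    proof -
      have "\<beta> s \<in> S (Suc n)" using \<beta>(1) that by (metis bij_betwE)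
      then have "\<beta> s < a + c \<and> Suc n \<le> \<beta> s + b" using step.IH by blast
      then show ?thesis using \<beta>(2)[OF that] by auto
    qed
    then show ?case by blast
  qed
  have "S k \<subseteq> H1_line a b c k" if "k \<le> ?K" for k
  proof (cases "k = ?K")
    case True
    then show ?thesis using S H1_line_last[OF assms] by (simp add: sequences_to_def)
  next
    case False
    then have "S k \<subseteq> {..<row_end c k}" using S that by (simp add: sequences_to_def)
    then have "j \<in> H1_line a b c k" if "j \<in> S k" for j
      using below[OF \<open>k \<le> ?K\<close>] that unfolding H1_line_def less_row_end_iff[symmetric] by blast
    then show ?thesis by blast
  qed
  then show "S \<in> line_sequences ?K (H1_line a b c)"
    using S by (simp add: line_sequences_def sequences_to_def H1_line_first H1_line_last[OF assms])
qed

text \<open>On an odd line \<open>2 m + 1\<close> with \<open>m \<ge> a\<close> the topmost height in front of the wall lies above the northern side,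
  so it always is a hole and contributes 1/2.\<close>
lemma prod_wall_weight:
  assumes "a \<le> b" "S \<in> line_sequences (a + b) (H1_line a b c)"
  shows "(\<Prod>k<a + b. wall_weight c k (S k))
    = (1 / 2) ^ ((a + b) div 2 - a) * (\<Prod>m<a. if c + m \<in> S (2 * m + 1) then 1 else 1 / 2)"
proof -
  let ?K = "a + b"
  have "(\<Prod>k<?K. wall_weight c k (S k)) = (\<Prod>k\<in>(\<lambda>m. 2 * m + 1) ` {..<?K div 2}. wall_weight c k (S k))"
  proof (rule prod.mono_neutral_right)
    show "\<forall>i\<in>{..<?K} - (\<lambda>m. 2 * m + 1) ` {..<?K div 2}. wall_weight c i (S i) = 1"
    proof
      fix i assume i: "i \<in> {..<?K} - (\<lambda>m. 2 * m + 1) ` {..<?K div 2}"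
      have "even i"
      proof (rule ccontr)
        assume "odd i"
        then obtain m where "i = 2 * m + 1" by (elim oddE)
        moreover from this have "m < ?K div 2" using i by auto
        ultimately show False using i by auto
      qed
      then show "wall_weight c i (S i) = 1" by (simp add: wall_weight_def)
    qed
  qed auto
  also have "\<dots> = (\<Prod>m<?K div 2. wall_weight c (2 * m + 1) (S (2 * m + 1)))"
    by (subst prod.reindex) (auto simp: inj_on_def)
  also have "\<dots> = (\<Prod>m<a + (?K div 2 - a). if c + m \<in> S (2 * m + 1) then 1 else 1 / 2)"
    using assms(1) by (intro prod.cong) (auto simp: wall_weight_def)
  also have "\<dots> = (\<Prod>m<a. if c + m \<in> S (2 * m + 1) then 1 else 1 / 2)
      * (\<Prod>m<?K div 2 - a. if c + (a + m) \<in> S (2 * (a + m) + 1) then 1 else 1 / 2)"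
    by (rule prod_split_at)
  also have "(\<Prod>m<?K div 2 - a. if c + (a + m) \<in> S (2 * (a + m) + 1) then 1 else 1 / 2)
      = (\<Prod>m<?K div 2 - a. 1 / 2 :: real)"
  proof (rule prod.cong)
    fix m assume "m \<in> {..<?K div 2 - a}"
    then have "2 * (a + m) + 1 \<le> ?K" by auto
    then have "S (2 * (a + m) + 1) \<subseteq> H1_line a b c (2 * (a + m) + 1)"
      using assms(2) by (simp add: line_sequences_def)
    then show "(if c + (a + m) \<in> S (2 * (a + m) + 1) then 1 else 1 / 2) = (1 / 2 :: real)"
      by (auto simp: H1_line_def)
  qed simp
  finally show ?thesis by simp
qed

lemma sum_matchings_H1_line:
  assumes "a \<le> b"
  shows "(\<Sum>\<sigma>\<in>matchings (a + b) (H1_line a b c).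
      \<Prod>m<a. if \<sigma> (2 * m + 1, c + m) = (2 * m + 1, c + m) then 1 / 2 else 1)
    = 2 ^ ((a + b) div 2 - a) * weighted_count c (a + b) {a..<a + c}"
proof -
  let ?K = "a + b" and ?J = "H1_line a b c"
  have "(\<Sum>\<sigma>\<in>matchings ?K ?J. \<Prod>m<a. if \<sigma> (2 * m + 1, c + m) = (2 * m + 1, c + m) then 1 / 2 else 1)
      = (\<Sum>\<sigma>\<in>matchings ?K ?J. \<Prod>m<a. if c + m \<in> moving_edges ?K ?J \<sigma> (2 * m + 1) then 1 else 1 / 2 :: real)"
  proof (intro sum.cong prod.cong refl)
    fix m assume "m \<in> {..<a}"
    then have "c + m \<in> ?J (2 * m + 1)" "2 * m + 1 < ?K" using assms by (auto simp: H1_line_def)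
    then show "(if \<sigma> (2 * m + 1, c + m) = (2 * m + 1, c + m) then 1 / 2 else 1)
        = (if c + m \<in> moving_edges ?K ?J \<sigma> (2 * m + 1) then 1 else 1 / 2 :: real)" for \<sigma>
      by (auto simp: moving_edges_def)
  qed
  also have "\<dots> = (\<Sum>S\<in>line_sequences ?K ?J. \<Prod>m<a. if c + m \<in> S (2 * m + 1) then 1 else 1 / 2)"
    by (rule sum.reindex_bij_betw[OF bij_betw_matchings_line_sequences])
  also have "\<dots> = (\<Sum>S\<in>line_sequences ?K ?J. 2 ^ (?K div 2 - a) * (\<Prod>k<?K. wall_weight c k (S k)))"
    using prod_wall_weight[OF assms] by (intro sum.cong refl) (simp add: power_one_over)
  also have "\<dots> = 2 ^ (?K div 2 - a) * weighted_count c ?K {a..<a + c}"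
    unfolding line_sequences_H1_line[OF assms] sum_distrib_left[symmetric] sum_sequences_to ..
  finally show ?thesis .
qed

section \<open>Coordinates, unit triangles and lozenges\<close>

text \<open>The lattice basis \<open>e\<close>, \<open>f\<close> is used as coordinate system; \<open>xc\<close> and \<open>yc\<close> are the coordinate functions.\<close>
definition pt :: "real \<Rightarrow> real \<Rightarrow> real \<times> real" where
  "pt x y = x *\<^sub>R e_vec + y *\<^sub>R f_vec"

definition xc :: "real \<times> real \<Rightarrow> real" where "xc p = fst p - snd p / sqrt 3"
definition yc :: "real \<times> real \<Rightarrow> real" where "yc p = 2 * snd p / sqrt 3"

lemma xc_pt [simp]: "xc (pt x y) = x" and yc_pt [simp]: "yc (pt x y) = y"
  by (simp_all add: pt_def xc_def yc_def e_vec_def f_vec_def)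

lemma pt_xc_yc [simp]: "pt (xc p) (yc p) = p"
  by (cases p) (simp add: pt_def xc_def yc_def e_vec_def f_vec_def)

lemma pt_eq_iff: "p = q \<longleftrightarrow> xc p = xc q \<and> yc p = yc q"
  by (metis pt_xc_yc)

lemma xc_linear [simp]: "xc (p + q) = xc p + xc q" "xc (p - q) = xc p - xc q"
    "xc (r *\<^sub>R p) = r * xc p" "xc (- p) = - xc p" "xc 0 = 0"
  by (simp_all add: xc_def field_simps)

lemma yc_linear [simp]: "yc (p + q) = yc p + yc q" "yc (p - q) = yc p - yc q"
    "yc (r *\<^sub>R p) = r * yc p" "yc (- p) = - yc p" "yc 0 = 0"
  by (simp_all add: yc_def field_simps)

lemma xc_basis [simp]: "xc e_vec = 1" "xc f_vec = 0" "xc g_vec = - 1"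
  and yc_basis [simp]: "yc e_vec = 0" "yc f_vec = 1" "yc g_vec = 1"
  by (simp_all add: xc_def yc_def g_vec_def e_vec_def f_vec_def)

lemma continuous_xc: "continuous_on S xc" and continuous_yc: "continuous_on S yc"
  unfolding xc_def yc_def by (auto intro!: continuous_intros)

text \<open>The triangles with label \<open>(i, j)\<close> are the lower and the upper half of the unit rhombus with lower left corner
  \<open>(i, j)\<close>; the Boolean selects the lower half, which has its horizontal side at the bottom.\<close>
definition tri :: "bool \<times> int \<times> int \<Rightarrow> (real \<times> real) set" where
  "tri = (\<lambda>(u, i, j). if u
     then {p. i \<le> xc p \<and> j \<le> yc p \<and> xc p + yc p \<le> i + j + 1}
     else {p. xc p \<le> i + 1 \<and> yc p \<le> j + 1 \<and> i + j + 1 \<le> xc p + yc p})"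

definition open_tri :: "bool \<times> int \<times> int \<Rightarrow> (real \<times> real) set" where
  "open_tri = (\<lambda>(u, i, j). if u
     then {p. i < xc p \<and> j < yc p \<and> xc p + yc p < i + j + 1}
     else {p. xc p < i + 1 \<and> yc p < j + 1 \<and> i + j + 1 < xc p + yc p})"

definition center :: "bool \<times> int \<times> int \<Rightarrow> real \<times> real" where
  "center = (\<lambda>(u, i, j). if u then pt (i + 1 / 3) (j + 1 / 3) else pt (i + 2 / 3) (j + 2 / 3))"

lemma center_in_open_tri: "center t \<in> open_tri t"
  by (cases t) (simp add: center_def open_tri_def)

lemma open_open_tri: "open (open_tri t)"
  by (cases t)
     (auto simp: open_tri_def intro!: open_Collect_conj open_Collect_less continuous_on_add
        continuous_on_const continuous_xc continuous_yc)

lemma open_tri_subset: "open_tri t \<subseteq> tri t"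
  by (cases t) (auto simp: tri_def open_tri_def)

lemma center_in_tri: "center t \<in> tri t"
  using center_in_open_tri open_tri_subset by blast

lemma int_le_of_less: "real_of_int m < real_of_int n + 1 \<Longrightarrow> m \<le> n"
  by linarith

text \<open>The coordinates of an interior point of a triangle are strictly between consecutive integers, which forces the
  integer bounds of any triangle that contains it.\<close>
lemma open_tri_unique:
  assumes "p \<in> open_tri t" "p \<in> tri t'"
  shows "t = t'"
proof -
  obtain u i j u' i' j' where t: "t = (u, i, j)" "t' = (u', i', j')" by (cases t, cases t')
  show ?thesis
  proof (cases u; cases u')
    assume "u" "u'"
    then have "real_of_int i' < i + 1" "real_of_int j' < j + 1" "real_of_int (i + j) < real_of_int (i' + j') + 1"
      using assms t by (auto simp: tri_def open_tri_def)
    then have "i' \<le> i" "j' \<le> j" "i + j \<le> i' + j'" by (auto dest!: int_le_of_less)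
    then show ?thesis using t \<open>u\<close> \<open>u'\<close> by simp
  next
    assume "u" "\<not> u'"
    then have "real_of_int i < i' + 1" "real_of_int j < j' + 1" "real_of_int (i' + j') < real_of_int (i + j)"
      using assms t by (auto simp: tri_def open_tri_def)
    then have "i \<le> i'" "j \<le> j'" "i' + j' < i + j" by (auto dest!: int_le_of_less)
    then show ?thesis by simp
  next
    assume "\<not> u" "u'"
    then have "real_of_int i' < i + 1" "real_of_int j' < j + 1" "real_of_int (i + j) < real_of_int (i' + j')"
      using assms t by (auto simp: tri_def open_tri_def)
    then have "i' \<le> i" "j' \<le> j" "i + j < i' + j'" by (auto dest!: int_le_of_less)
    then show ?thesis by simp
  next
    assume "\<not> u" "\<not> u'"
    then have "real_of_int i < i' + 1" "real_of_int j < j' + 1" "real_of_int (i' + j') < real_of_int (i + j) + 1"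
      using assms t by (auto simp: tri_def open_tri_def)
    then have "i \<le> i'" "j \<le> j'" "i' + j' \<le> i + j" by (auto dest!: int_le_of_less)
    then show ?thesis using t \<open>\<not> u\<close> \<open>\<not> u'\<close> by simp
  qed
qed

lemma center_in_tri_iff: "center t \<in> tri t' \<longleftrightarrow> t = t'"
  using open_tri_unique[OF center_in_open_tri] center_in_tri by blast

lemma tri_eq_iff: "tri t = tri t' \<longleftrightarrow> t = t'"
  using center_in_tri_iff center_in_tri by metis

text \<open>The segment from \<open>p\<close> to the center runs inside the open triangle, except possibly for \<open>p\<close> itself.\<close>
lemma open_meets_open_tri:
  assumes "open O'" "p \<in> O'" "p \<in> tri t"
  shows "O' \<inter> open_tri t \<noteq> {}"
proof -
  \<comment> \<open>points that tend to \<open>p\<close> from inside the open triangle\<close>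
  define q where "q n = p + inverse (real (Suc n)) *\<^sub>R (center t - p)" for n
  have "q \<longlonglongrightarrow> p + 0 *\<^sub>R (center t - p)"
    unfolding q_def by (intro tendsto_intros LIMSEQ_inverse_real_of_nat)
  then have "eventually (\<lambda>n. q n \<in> O') sequentially"
    using assms(1,2) by (intro topological_tendstoD[where l = p]) auto
  then obtain n where n: "q n \<in> O'" by (auto simp: eventually_sequentially)
  define r where "r = inverse (real (Suc n))"
  have r: "0 < r" "r \<le> 1" by (auto simp: r_def field_simps)
  have comb: "l < x + r * (z - x)" if "l \<le> x" "l < z" for l x z :: real
  proof -
    have "0 \<le> (1 - r) * (x - l)" "0 < r * (z - l)" using r that by auto
    then show ?thesis by (simp add: algebra_simps)
  qed
  have comb': "x + r * (z - x) < l" if "x \<le> l" "z < l" for l x z :: real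
    using comb[of "- l" "- x" "- z"] that by (simp add: algebra_simps)
  have "q n \<in> open_tri t"
  proof (cases t)
    case (fields u i j)
    let ?c = "center t"
    have q: "xc (q n) = xc p + r * (xc ?c - xc p)" "yc (q n) = yc p + r * (yc ?c - yc p)"
      "xc (q n) + yc (q n) = (xc p + yc p) + r * ((xc ?c + yc ?c) - (xc p + yc p))"
      by (simp_all add: q_def r_def algebra_simps)
    show ?thesis
    proof (cases u)
      case True
      have "i < xc (q n)" unfolding q(1)
        by (rule comb) (use assms(3) center_in_open_tri[of t] fields True in \<open>auto simp: tri_def open_tri_def\<close>)
      moreover have "j < yc (q n)" unfolding q(2)
        by (rule comb) (use assms(3) center_in_open_tri[of t] fields True in \<open>auto simp: tri_def open_tri_def\<close>)
      moreover have "xc (q n) + yc (q n) < i + j + 1" unfolding q(3)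
        by (rule comb') (use assms(3) center_in_open_tri[of t] fields True in \<open>auto simp: tri_def open_tri_def\<close>)
      ultimately show ?thesis using fields True by (simp add: open_tri_def)
    next
      case False
      have "xc (q n) < i + 1" unfolding q(1)
        by (rule comb') (use assms(3) center_in_open_tri[of t] fields False in \<open>auto simp: tri_def open_tri_def\<close>)
      moreover have "yc (q n) < j + 1" unfolding q(2)
        by (rule comb') (use assms(3) center_in_open_tri[of t] fields False in \<open>auto simp: tri_def open_tri_def\<close>)
      moreover have "i + j + 1 < xc (q n) + yc (q n)" unfolding q(3)
        by (rule comb) (use assms(3) center_in_open_tri[of t] fields False in \<open>auto simp: tri_def open_tri_def\<close>)
      ultimately show ?thesis using fields False by (simp add: open_tri_def)
    qed
  qed
  then show ?thesis using n by blast
qed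

lemma tri_True_hull: "tri (True, i, j) = convex hull {pt i j, pt (i + 1) j, pt i (j + 1)}"
proof -
  have "p \<in> tri (True, i, j) \<longleftrightarrow> (\<exists>u v. p = pt i j + u *\<^sub>R (pt (i + 1) j - pt i j)
      + v *\<^sub>R (pt i (j + 1) - pt i j) \<and> 0 \<le> u \<and> 0 \<le> v \<and> u + v \<le> 1)" for p
  proof -
    have "(\<exists>(u :: real) (v :: real). xc p = i + u \<and> yc p = j + v \<and> 0 \<le> u \<and> 0 \<le> v \<and> u + v \<le> 1)
        \<longleftrightarrow> i \<le> xc p \<and> j \<le> yc p \<and> xc p + yc p \<le> i + j + 1"
      (is "?L \<longleftrightarrow> ?R")
    proof
      show ?R if ?L using that by auto
      show ?L if ?R by (rule exI[of _ "xc p - i"], rule exI[of _ "yc p - j"]) (use that in simp)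
    qed
    then show ?thesis by (simp add: tri_def pt_eq_iff[of p])
  qed
  then show ?thesis unfolding convex_hull_3_alt by blast
qed

lemma tri_False_hull: "tri (False, i, j) = convex hull {pt (i + 1) j, pt i (j + 1), pt (i + 1) (j + 1)}"
proof -
  have "p \<in> tri (False, i, j) \<longleftrightarrow> (\<exists>u v. p = pt (i + 1) (j + 1) + u *\<^sub>R (pt i (j + 1) - pt (i + 1) (j + 1))
      + v *\<^sub>R (pt (i + 1) j - pt (i + 1) (j + 1)) \<and> 0 \<le> u \<and> 0 \<le> v \<and> u + v \<le> 1)" for p
  proof -
    have "(\<exists>(u :: real) (v :: real). xc p = i + 1 - u \<and> yc p = j + 1 - v \<and> 0 \<le> u \<and> 0 \<le> v \<and> u + v \<le> 1)
        \<longleftrightarrow> xc p \<le> i + 1 \<and> yc p \<le> j + 1 \<and> i + j + 1 \<le> xc p + yc p"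
      (is "?L \<longleftrightarrow> ?R")
    proof
      show ?R if ?L using that by auto
      show ?L if ?R by (rule exI[of _ "i + 1 - xc p"], rule exI[of _ "j + 1 - yc p"]) (use that in simp)
    qed
    then show ?thesis by (simp add: tri_def pt_eq_iff[of p])
  qed
  then have "tri (False, i, j) = convex hull {pt (i + 1) (j + 1), pt i (j + 1), pt (i + 1) j}"
    unfolding convex_hull_3_alt by blast
  then show ?thesis by (simp add: insert_commute)
qed

lemma unit_triangle_iff: "unit_triangle T \<longleftrightarrow> (\<exists>t. T = tri t)"
proof -
  have up: "convex hull {pt x y, pt x y + e_vec, pt x y + f_vec} = tri (True, x, y)" for x y :: int
  proof -
    have "pt x y + e_vec = pt (x + 1) y" "pt x y + f_vec = pt x (y + 1)"
      by (simp_all add: pt_eq_iff)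
    then show ?thesis by (simp add: tri_True_hull)
  qed
  have down: "convex hull {pt x y, pt x y + f_vec, pt x y + g_vec} = tri (False, x - 1, y)" for x y :: int
  proof -
    have "pt x y + f_vec = pt x (y + 1)" "pt x y + g_vec = pt (x - 1) (y + 1)"
      by (simp_all add: pt_eq_iff)
    then show ?thesis by (simp add: tri_False_hull insert_commute)
  qed
  have "unit_triangle T \<longleftrightarrow> (\<exists>(x :: int) (y :: int).
      T = convex hull {pt x y, pt x y + e_vec, pt x y + f_vec} \<or> T = convex hull {pt x y, pt x y + f_vec, pt x y + g_vec})"
    unfolding unit_triangle_def tri_lattice_def pt_def[symmetric] by blast
  also have "\<dots> \<longleftrightarrow> (\<exists>x y. T = tri (True, x, y) \<or> T = tri (False, x - 1, y))"
    unfolding up down ..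
  also have "\<dots> \<longleftrightarrow> (\<exists>t. T = tri t)"
  proof
    assume "\<exists>t. T = tri t"
    then obtain u i j where "T = tri (u, i, j)" by auto
    then have "T = tri (True, i, j) \<or> T = tri (False, (i + 1) - 1, j)" by (cases u) simp_all
    then show "\<exists>x y. T = tri (True, x, y) \<or> T = tri (False, x - 1, y)" by blast
  qed blast
  finally show ?thesis .
qed

text \<open>The three upward triangles next to a downward one: across its diagonal, its right and its upper side.\<close>
definition adjacent :: "int \<times> int \<Rightarrow> int \<times> int \<Rightarrow> bool" where
  "adjacent = (\<lambda>(i, j) u. u = (i, j) \<or> u = (i + 1, j) \<or> u = (i, j + 1))"

text \<open>Of two distinct points one lies strictly beyond the bounds of both triangles in some coordinate; comparing its
  coordinate sum with the third side of each triangle decides the integer corners.\<close>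
lemma same_orientation_overlap:
  assumes "P \<noteq> Q" "P \<in> tri (u, i, j)" "P \<in> tri (u, i', j')" "Q \<in> tri (u, i, j)" "Q \<in> tri (u, i', j')"
  shows "i = i' \<and> j = j'"
proof -
  have *: "i = i' \<and> j = j'"
    if "real_of_int (i + j') < real_of_int (i + j) + 1" "real_of_int (i + j') < real_of_int (i' + j') + 1"
      "real_of_int (i' + j) < real_of_int (i + j) + 1" "real_of_int (i' + j) < real_of_int (i' + j') + 1"
    using that[THEN int_le_of_less] by simp
  have "xc P < xc Q \<or> xc Q < xc P \<or> yc P < yc Q \<or> yc Q < yc P"
    using assms(1) pt_eq_iff[of P Q] by linarith
  then show ?thesis
    using assms(2-5) by (cases u) (elim disjE; rule *; simp add: tri_def)+
qed

text \<open>Apart from the three adjacent positions, an upward triangle meets a downward one in at most one point.\<close>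
lemma opposite_orientation_overlap:
  assumes "P \<noteq> Q" "P \<in> tri (False, i, j)" "P \<in> tri (True, i', j')" "Q \<in> tri (False, i, j)" "Q \<in> tri (True, i', j')"
  shows "adjacent (i, j) (i', j')"
proof -
  have P: "i' \<le> xc P" "j' \<le> yc P" "xc P + yc P \<le> i' + j' + 1" "xc P \<le> i + 1" "yc P \<le> j + 1" "i + j + 1 \<le> xc P + yc P"
    and Q: "i' \<le> xc Q" "j' \<le> yc Q" "xc Q + yc Q \<le> i' + j' + 1" "xc Q \<le> i + 1" "yc Q \<le> j + 1" "i + j + 1 \<le> xc Q + yc Q"
    using assms by (auto simp: tri_def)
  have ne: "xc P \<noteq> xc Q \<or> yc P \<noteq> yc Q" using assms(1) pt_eq_iff by blast
  have "real_of_int i' \<le> real_of_int (i + 1)" "real_of_int j' \<le> real_of_int (j + 1)"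
      "real_of_int (i + j) \<le> real_of_int (i' + j')"
    using P by simp_all
  then have le: "i' \<le> i + 1" "j' \<le> j + 1" "i + j \<le> i' + j'" by (simp_all only: of_int_le_iff)
  have "\<not> (i' = i + 1 \<and> j' = j + 1)"
  proof
    assume "i' = i + 1 \<and> j' = j + 1"
    then have "xc P = i + 1" "xc Q = i + 1" "yc P = j + 1" "yc Q = j + 1" using P Q by simp_all
    then show False using ne by simp
  qed
  moreover have "\<not> (i' = i + 1 \<and> j' = j - 1)"
  proof
    assume "i' = i + 1 \<and> j' = j - 1"
    then have "xc P = i + 1" "xc Q = i + 1" "yc P = j" "yc Q = j" using P Q by simp_all
    then show False using ne by simp
  qed
  moreover have "\<not> (i' = i - 1 \<and> j' = j + 1)"
  proof
    assume "i' = i - 1 \<and> j' = j + 1"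
    then have "xc P = i" "xc Q = i" "yc P = j + 1" "yc Q = j + 1" using P Q by simp_all
    then show False using ne by simp
  qed
  ultimately show ?thesis using le unfolding adjacent_def prod.case prod.inject by linarith
qed

lemma segment_pt:
  "p \<in> closed_segment (pt x y) (pt x' y')
    \<longleftrightarrow> (\<exists>u. 0 \<le> u \<and> u \<le> 1 \<and> xc p = (1 - u) * x + u * x' \<and> yc p = (1 - u) * y + u * y')"
  unfolding in_segment by (auto simp: pt_eq_iff[of p])

lemma lozenge_iff:
  "lozenge L \<longleftrightarrow> (\<exists>s u. adjacent s u \<and> L = tri (False, s) \<union> tri (True, u))"
proof
  assume "lozenge L"
  then obtain t t' P Q where t: "tri t \<noteq> tri t'" "P \<noteq> Q" "tri t \<inter> tri t' = closed_segment P Q"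
      "L = tri t \<union> tri t'"
    unfolding lozenge_def unit_triangle_iff by blast
  have PQ: "P \<in> tri t" "P \<in> tri t'" "Q \<in> tri t" "Q \<in> tri t'"
    using t(3) ends_in_segment by blast+
  obtain u i j u' i' j' where uij: "t = (u, i, j)" "t' = (u', i', j')" by (cases t, cases t')
  have "u \<noteq> u'"
  proof
    assume "u = u'"
    then have "i = i' \<and> j = j'"
      using same_orientation_overlap[OF t(2)] PQ uij by blast
    then show False using t(1) uij \<open>u = u'\<close> by simp
  qed
  show "\<exists>s u. adjacent s u \<and> L = tri (False, s) \<union> tri (True, u)"
  proof (cases u)
    case True
    then have "adjacent (i', j') (i, j)"
      using opposite_orientation_overlap[OF t(2)] PQ uij \<open>u \<noteq> u'\<close> by auto
    moreover have "L = tri (False, i', j') \<union> tri (True, i, j)" using t(4) uij True \<open>u \<noteq> u'\<close> by auto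
    ultimately show ?thesis by blast
  next
    case False
    then have "adjacent (i, j) (i', j')"
      using opposite_orientation_overlap[OF t(2)] PQ uij \<open>u \<noteq> u'\<close> by auto
    moreover have "L = tri (False, i, j) \<union> tri (True, i', j')" using t(4) uij False \<open>u \<noteq> u'\<close> by auto
    ultimately show ?thesis by blast
  qed
next
  assume "\<exists>s u. adjacent s u \<and> L = tri (False, s) \<union> tri (True, u)"
  then obtain i j v where v: "adjacent (i, j) v" and L: "L = tri (False, i, j) \<union> tri (True, v)" by auto
  have "\<exists>P Q. P \<noteq> Q \<and> tri (False, i, j) \<inter> tri (True, v) = closed_segment P Q"
  proof -
    consider "v = (i, j)" | "v = (i + 1, j)" | "v = (i, j + 1)" using v by (auto simp: adjacent_def)
    then show ?thesis
    proof cases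
      case 1
      have "p \<in> tri (False, i, j) \<inter> tri (True, v) \<longleftrightarrow> p \<in> closed_segment (pt i (j + 1)) (pt (i + 1) j)" for p
        unfolding segment_pt 1
        by (auto simp: tri_def algebra_simps intro!: exI[of _ "xc p - i"])
      then show ?thesis by (intro exI[of _ "pt i (j + 1)"] exI[of _ "pt (i + 1) j"]) (auto simp: pt_eq_iff)
    next
      case 2
      have "p \<in> tri (False, i, j) \<inter> tri (True, v) \<longleftrightarrow> p \<in> closed_segment (pt (i + 1) j) (pt (i + 1) (j + 1))" for p
        unfolding segment_pt 2
        by (auto simp: tri_def algebra_simps intro!: exI[of _ "yc p - j"])
      then show ?thesis by (intro exI[of _ "pt (i + 1) j"] exI[of _ "pt (i + 1) (j + 1)"]) (auto simp: pt_eq_iff)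
    next
      case 3
      have "p \<in> tri (False, i, j) \<inter> tri (True, v) \<longleftrightarrow> p \<in> closed_segment (pt i (j + 1)) (pt (i + 1) (j + 1))" for p
        unfolding segment_pt 3
        by (auto simp: tri_def algebra_simps intro!: exI[of _ "xc p - i"])
      then show ?thesis by (intro exI[of _ "pt i (j + 1)"] exI[of _ "pt (i + 1) (j + 1)"]) (auto simp: pt_eq_iff)
    qed
  qed
  moreover have "tri (False, i, j) \<noteq> tri (True, v)" by (simp add: tri_eq_iff)
  ultimately show "lozenge L" unfolding lozenge_def unit_triangle_iff using L by blast
qed

section \<open>Lozenge tilings as matchings\<close>

text \<open>Line \<open>k\<close> is \<open>x + y = k\<close>, so its edge at height \<open>j\<close> is the diagonal of the rhombus with lower left corner
  \<open>(k - 1 - j, j)\<close>.\<close>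
definition down_at :: "nat \<times> nat \<Rightarrow> (real \<times> real) set" where
  "down_at = (\<lambda>(k, j). tri (False, int k - 1 - int j, int j))"

definition up_at :: "nat \<times> nat \<Rightarrow> (real \<times> real) set" where
  "up_at = (\<lambda>(k, j). tri (True, int k - 1 - int j, int j))"

definition region :: "nat \<Rightarrow> (nat \<Rightarrow> nat set) \<Rightarrow> (real \<times> real) set" where
  "region K J = \<Union>(down_at ` Sigma {..<K} J) \<union> \<Union>(up_at ` Sigma {1..K} J)"

definition tiling_of :: "nat \<Rightarrow> (nat \<Rightarrow> nat set) \<Rightarrow> (nat \<times> nat \<Rightarrow> nat \<times> nat) \<Rightarrow> (real \<times> real) set set" where
  "tiling_of K J \<sigma> = (\<lambda>d. down_at d \<union> up_at (\<sigma> d)) ` Sigma {..<K} J"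

lemma down_up_union_eq_iff:
  "down_at d \<union> up_at u = down_at d' \<union> up_at u' \<longleftrightarrow> d = d' \<and> u = u'"
proof
  assume eq: "down_at d \<union> up_at u = down_at d' \<union> up_at u'"
  obtain k j k' j' where d: "d = (k, j)" "d' = (k', j')" by (cases d, cases d')
  obtain l i l' i' where u: "u = (l, i)" "u' = (l', i')" by (cases u, cases u')
  have "center (False, int k - 1 - int j, int j) \<in> down_at d' \<union> up_at u'"
    unfolding eq[symmetric] by (simp add: d down_at_def center_in_tri)
  moreover have "center (True, int l - 1 - int i, int i) \<in> down_at d' \<union> up_at u'"
    unfolding eq[symmetric] by (simp add: u up_at_def center_in_tri)
  ultimately show "d = d' \<and> u = u'"
    by (auto simp: d u down_at_def up_at_def center_in_tri_iff)
qed simp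

lemma lozenge_down_up: "u \<in> nbrs d \<Longrightarrow> lozenge (down_at d \<union> up_at u)"
  unfolding lozenge_iff
  by (cases d, rule exI[of _ "(int (fst d) - 1 - int (snd d), int (snd d))"],
      rule exI[of _ "(int (fst u) - 1 - int (snd u), int (snd u))"])
     (auto simp: nbrs_def down_at_def up_at_def adjacent_def)

lemma down_in_region:
  assumes "tri (False, s) \<subseteq> region K J"
  shows "\<exists>d\<in>Sigma {..<K} J. down_at d = tri (False, s)"
proof -
  have "center (False, s) \<in> region K J" using assms center_in_tri by blast
  then show ?thesis
    unfolding region_def down_at_def up_at_def by (auto simp: center_in_tri_iff)
qed

lemma up_in_region:
  assumes "tri (True, s) \<subseteq> region K J"
  shows "\<exists>u\<in>Sigma {1..K} J. up_at u = tri (True, s)"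
proof -
  have "center (True, s) \<in> region K J" using assms center_in_tri by blast
  then show ?thesis
    unfolding region_def down_at_def up_at_def by (auto simp: center_in_tri_iff)
qed

lemma lozenge_in_region:
  assumes "lozenge L" "L \<subseteq> region K J"
  shows "\<exists>d\<in>Sigma {..<K} J. \<exists>u\<in>Sigma {1..K} J. u \<in> nbrs d \<and> L = down_at d \<union> up_at u"
proof -
  obtain s v where sv: "adjacent s v" "L = tri (False, s) \<union> tri (True, v)"
    using assms(1) lozenge_iff by auto
  obtain d where d: "d \<in> Sigma {..<K} J" "down_at d = tri (False, s)"
    using down_in_region[of s K J] assms(2) sv by auto
  obtain u where u: "u \<in> Sigma {1..K} J" "up_at u = tri (True, v)"
    using up_in_region[of v K J] assms(2) sv by auto
  obtain k j l i where eq: "d = (k, j)" "u = (l, i)" by (cases d, cases u)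
  have s: "s = (int k - 1 - int j, int j)" and v: "v = (int l - 1 - int i, int i)"
    using d(2) u(2) by (auto simp: eq down_at_def up_at_def tri_eq_iff)
  have "u \<in> nbrs d"
    using sv(1) unfolding adjacent_def s v eq nbrs_def by auto
  then show ?thesis using d u sv(2) by blast
qed

text \<open>A nonempty open set in both unions meets the open part of some triangle of the first union, and a point there
  belongs to no other triangle.\<close>
lemma interior_overlap_imp_common_tri:
  assumes "interior (tri t1 \<union> tri t2) \<inter> interior (tri t3 \<union> tri t4) \<noteq> {}"
  shows "{t1, t2} \<inter> {t3, t4} \<noteq> {}"
proof -
  let ?O = "interior (tri t1 \<union> tri t2) \<inter> interior (tri t3 \<union> tri t4)"
  have "open ?O" by auto
  obtain p where p: "p \<in> ?O" using assms by auto
  then have "p \<in> tri t1 \<or> p \<in> tri t2" using interior_subset by blast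
  then obtain t where t: "t \<in> {t1, t2}" "p \<in> tri t" by blast
  obtain q where q: "q \<in> ?O" "q \<in> open_tri t" using open_meets_open_tri[OF \<open>open ?O\<close> p t(2)] by blast
  then have "q \<in> tri t3 \<or> q \<in> tri t4" using interior_subset by blast
  then have "t = t3 \<or> t = t4" using open_tri_unique[OF q(2)] by blast
  then show ?thesis using t(1) by blast
qed

lemma common_tri_imp_interior_overlap:
  assumes "tri t \<subseteq> L" "tri t \<subseteq> L'"
  shows "interior L \<inter> interior L' \<noteq> {}"
proof -
  have "center t \<in> interior A" if "tri t \<subseteq> A" for A
    by (rule interiorI[OF open_open_tri center_in_open_tri]) (use open_tri_subset that in blast)
  then show ?thesis using assms by blast
qed

lemma lozenge_tiling_tiling_of:
  assumes "\<sigma> \<in> matchings K J"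
  shows "lozenge_tiling (region K J) (tiling_of K J \<sigma>)"
proof -
  have bij: "bij_betw \<sigma> (Sigma {..<K} J) (Sigma {1..K} J)"
    and nb: "\<And>d. d \<in> Sigma {..<K} J \<Longrightarrow> \<sigma> d \<in> nbrs d"
    using assms by (auto simp: matchings_def)
  have "lozenge L" if "L \<in> tiling_of K J \<sigma>" for L
    using that nb lozenge_down_up unfolding tiling_of_def by blast
  moreover have "interior L \<inter> interior L' = {}"
    if LL': "L \<in> tiling_of K J \<sigma>" "L' \<in> tiling_of K J \<sigma>" "L \<noteq> L'" for L L'
  proof (rule ccontr)
    assume overlap: "interior L \<inter> interior L' \<noteq> {}"
    obtain d d' where d: "d \<in> Sigma {..<K} J" "d' \<in> Sigma {..<K} J"
      and L: "L = down_at d \<union> up_at (\<sigma> d)" "L' = down_at d' \<union> up_at (\<sigma> d')"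
      using LL' by (auto simp: tiling_of_def)
    have "d \<noteq> d'" using L LL'(3) by auto
    then have "\<sigma> d \<noteq> \<sigma> d'" using bij d by (auto simp: bij_betw_def inj_on_def)
    obtain k j k' j' where eq: "d = (k, j)" "d' = (k', j')" by (cases d, cases d')
    obtain l i l' i' where \<sigma>eq: "\<sigma> d = (l, i)" "\<sigma> d' = (l', i')" by (cases "\<sigma> d", cases "\<sigma> d'")
    have "{(False, int k - 1 - int j, int j), (True, int l - 1 - int i, int i)}
        \<inter> {(False, int k' - 1 - int j', int j'), (True, int l' - 1 - int i', int i')} \<noteq> {}"
      using overlap unfolding L \<sigma>eq unfolding eq down_at_def up_at_def prod.case
      by (rule interior_overlap_imp_common_tri)
    moreover have "\<not> (k = k' \<and> j = j')" "\<not> (l = l' \<and> i = i')"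
      using \<open>d \<noteq> d'\<close> \<open>\<sigma> d \<noteq> \<sigma> d'\<close> eq \<sigma>eq by auto
    ultimately show False by auto
  qed
  moreover have "\<Union>(tiling_of K J \<sigma>) = region K J"
  proof -
    have "\<Union>(tiling_of K J \<sigma>) = \<Union>(down_at ` Sigma {..<K} J) \<union> \<Union>(up_at ` \<sigma> ` Sigma {..<K} J)"
      unfolding tiling_of_def by blast
    then show ?thesis unfolding bij_betw_imp_surj_on[OF bij] region_def .
  qed
  ultimately show ?thesis unfolding lozenge_tiling_def pairwise_def by blast
qed

text \<open>The center of a triangle of the region is covered by a lozenge of the tiling, which must contain this triangle.
  It is the only one, because two lozenges with a common triangle have overlapping interiors.\<close>
lemma lozenge_tiling_imp_tiling_of:
  assumes "lozenge_tiling (region K J) \<T>"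
  shows "\<exists>\<sigma>\<in>matchings K J. \<T> = tiling_of K J \<sigma>"
proof -
  let ?D = "Sigma {..<K} J" and ?U = "Sigma {1..K} J"
  note tiling = assms[unfolded lozenge_tiling_def]
  note loz_all = tiling[THEN conjunct1]
    and pw = tiling[THEN conjunct2, THEN conjunct1]
    and un = tiling[THEN conjunct2, THEN conjunct2]
  have loz: "lozenge L" if "L \<in> \<T>" for L using loz_all that by (rule bspec)
  have disj: "L = L'" if "L \<in> \<T>" "L' \<in> \<T>" "interior L \<inter> interior L' \<noteq> {}" for L L'
    using pairwiseD[OF pw that(1,2)] that(3) by argo
  have shape: "\<exists>d\<in>?D. \<exists>u\<in>?U. u \<in> nbrs d \<and> L = down_at d \<union> up_at u" if "L \<in> \<T>" for L
    using lozenge_in_region[OF loz[OF that]] that un by blast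
  have same: "down_at d \<union> up_at u = down_at d' \<union> up_at u'"
    if "down_at d \<union> up_at u \<in> \<T>" "down_at d' \<union> up_at u' \<in> \<T>" "d = d' \<or> u = u'" for d u d' u'
  proof (rule disj[OF that(1,2)])
    obtain k j l i where eq: "d = (k, j)" "u = (l, i)" by (cases d, cases u)
    show "interior (down_at d \<union> up_at u) \<inter> interior (down_at d' \<union> up_at u') \<noteq> {}"
      using that(3)
    proof
      assume "d = d'"
      then show ?thesis
        by (intro common_tri_imp_interior_overlap[of "(False, int k - 1 - int j, int j)"]) (auto simp: eq down_at_def)
    next
      assume "u = u'"
      then show ?thesis
        by (intro common_tri_imp_interior_overlap[of "(True, int l - 1 - int i, int i)"]) (auto simp: eq up_at_def)
    qed
  qed
  have ex_u: "\<exists>u\<in>?U. u \<in> nbrs d \<and> down_at d \<union> up_at u \<in> \<T>" if d: "d \<in> ?D" for d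
  proof -
    obtain k j where kj: "d = (k, j)" by (cases d)
    let ?c = "center (False, int k - 1 - int j, int j)"
    have "?c \<in> down_at d" by (simp add: kj down_at_def center_in_tri)
    then have "?c \<in> \<Union>\<T>" unfolding un region_def using d by blast
    then obtain L where L: "L \<in> \<T>" "?c \<in> L" by blast
    obtain d' u where du: "d' \<in> ?D" "u \<in> ?U" "u \<in> nbrs d'" "L = down_at d' \<union> up_at u"
      using shape[OF L(1)] by blast
    have "d' = d"
      using L(2) unfolding du(4) by (auto simp: kj down_at_def up_at_def center_in_tri_iff split: prod.splits)
    then show ?thesis using du L by blast
  qed
  have ex_d: "\<exists>d\<in>?D. u \<in> nbrs d \<and> down_at d \<union> up_at u \<in> \<T>" if u: "u \<in> ?U" for u
  proof -
    obtain k j where kj: "u = (k, j)" by (cases u)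
    let ?c = "center (True, int k - 1 - int j, int j)"
    have "?c \<in> up_at u" by (simp add: kj up_at_def center_in_tri)
    then have "?c \<in> \<Union>\<T>" unfolding un region_def using u by blast
    then obtain L where L: "L \<in> \<T>" "?c \<in> L" by blast
    obtain d u' where du: "d \<in> ?D" "u' \<in> ?U" "u' \<in> nbrs d" "L = down_at d \<union> up_at u'"
      using shape[OF L(1)] by blast
    have "u' = u"
      using L(2) unfolding du(4) by (auto simp: kj down_at_def up_at_def center_in_tri_iff split: prod.splits)
    then show ?thesis using du L by blast
  qed
  have "\<forall>d\<in>?D. \<exists>u. u \<in> ?U \<and> u \<in> nbrs d \<and> down_at d \<union> up_at u \<in> \<T>"
    by (intro ballI) (use ex_u in \<open>simp only: Bex_def\<close>)
  from bchoice[OF this] obtain f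
    where f: "\<forall>d\<in>?D. f d \<in> ?U \<and> f d \<in> nbrs d \<and> down_at d \<union> up_at (f d) \<in> \<T>" ..
  define \<sigma> where "\<sigma> = restrict f ?D"
  have \<sigma>: "\<sigma> d \<in> ?U" "\<sigma> d \<in> nbrs d" "down_at d \<union> up_at (\<sigma> d) \<in> \<T>" if "d \<in> ?D" for d
    using bspec[OF f that] that by (simp_all add: \<sigma>_def)
  have unique: "d = d' \<and> u = u'"
    if "down_at d \<union> up_at u \<in> \<T>" "down_at d' \<union> up_at u' \<in> \<T>" "d = d' \<or> u = u'" for d u d' u'
    using same[OF that] down_up_union_eq_iff by blast
  have "bij_betw \<sigma> ?D ?U"
  proof (rule bij_betw_imageI)
    show "inj_on \<sigma> ?D" by (rule inj_onI) (use unique \<sigma>(3) in blast)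
    have "u \<in> \<sigma> ` ?D" if u: "u \<in> ?U" for u
    proof -
      obtain d where "d \<in> ?D" "down_at d \<union> up_at u \<in> \<T>" using ex_d[OF u] by blast
      then have "u = \<sigma> d" using unique \<sigma>(3) by blast
      then show ?thesis using \<open>d \<in> ?D\<close> by blast
    qed
    then show "\<sigma> ` ?D = ?U" using \<sigma>(1) by blast
  qed
  then have "\<sigma> \<in> matchings K J"
    unfolding matchings_def using \<sigma>(2) by (simp add: \<sigma>_def)
  moreover have "\<T> = tiling_of K J \<sigma>"
  proof (intro equalityI subsetI)
    fix L assume "L \<in> \<T>"
    then obtain d u where du: "d \<in> ?D" "L = down_at d \<union> up_at u" using shape by blast
    then have "u = \<sigma> d" using unique \<sigma>(3)[OF du(1)] \<open>L \<in> \<T>\<close> by blast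
    then show "L \<in> tiling_of K J \<sigma>" using du unfolding tiling_of_def by blast
  next
    fix L assume "L \<in> tiling_of K J \<sigma>"
    then show "L \<in> \<T>" using \<sigma>(3) unfolding tiling_of_def by blast
  qed
  ultimately show ?thesis by blast
qed

lemma bij_betw_matchings_tilings:
  "bij_betw (tiling_of K J) (matchings K J) {\<T>. lozenge_tiling (region K J) \<T>}"
proof (rule bij_betw_imageI)
  show "inj_on (tiling_of K J) (matchings K J)"
  proof (rule inj_onI)
    fix \<sigma> \<tau> assume \<sigma>: "\<sigma> \<in> matchings K J" and \<tau>: "\<tau> \<in> matchings K J"
      and eq: "tiling_of K J \<sigma> = tiling_of K J \<tau>"
    show "\<sigma> = \<tau>"
    proof (rule extensionalityI)
      show "\<sigma> \<in> extensional (Sigma {..<K} J)" "\<tau> \<in> extensional (Sigma {..<K} J)"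
        using \<sigma> \<tau> by (auto simp: matchings_def)
      fix d assume "d \<in> Sigma {..<K} J"
      then have "down_at d \<union> up_at (\<sigma> d) \<in> tiling_of K J \<tau>"
        unfolding eq[symmetric] unfolding tiling_of_def by (rule imageI)
      then obtain d' where "down_at d \<union> up_at (\<sigma> d) = down_at d' \<union> up_at (\<tau> d')"
        unfolding tiling_of_def by (rule imageE)
      then have "d = d' \<and> \<sigma> d = \<tau> d'" by (rule down_up_union_eq_iff[THEN iffD1])
      then show "\<sigma> d = \<tau> d" by (elim conjE) simp
    qed
  qed
  show "tiling_of K J ` matchings K J = {\<T>. lozenge_tiling (region K J) \<T>}"
  proof (intro equalityI subsetI)
    fix \<T> assume "\<T> \<in> tiling_of K J ` matchings K J"
    then show "\<T> \<in> {\<T>. lozenge_tiling (region K J) \<T>}"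
      using lozenge_tiling_tiling_of by (elim imageE) simp
  next
    fix \<T> assume "\<T> \<in> {\<T>. lozenge_tiling (region K J) \<T>}"
    then show "\<T> \<in> tiling_of K J ` matchings K J"
      using lozenge_tiling_imp_tiling_of[of K J \<T>] by (simp add: image_iff)
  qed
qed

section \<open>The hexagon with one cut corner\<close>

lemma convex_coordinate_box:
  "convex {p. l \<le> xc p \<and> xc p \<le> r \<and> b \<le> yc p \<and> yc p \<le> t \<and> m \<le> xc p + yc p \<and> xc p + yc p \<le> M}"
proof -
  have "linear xc" "linear yc" "linear (\<lambda>p. xc p + yc p)"
    by (rule linearI; simp add: algebra_simps)+
  then have "convex (xc -` {l..r} \<inter> yc -` {b..t} \<inter> (\<lambda>p. xc p + yc p) -` {m..M})"
    by (intro convex_Int convex_linear_vimage convex_real_interval)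
  moreover have "xc -` {l..r} \<inter> yc -` {b..t} \<inter> (\<lambda>p. xc p + yc p) -` {m..M}
      = {p. l \<le> xc p \<and> xc p \<le> r \<and> b \<le> yc p \<and> yc p \<le> t \<and> m \<le> xc p + yc p \<and> xc p + yc p \<le> M}"
    by auto
  ultimately show ?thesis by simp
qed

lemma convex_pt_combination:
  assumes "convex C" "pt x y \<in> C" "pt x' y' \<in> C" "0 \<le> u" "u \<le> 1"
    "X = x + u * (x' - x)" "Y = y + u * (y' - y)"
  shows "pt X Y \<in> C"
proof -
  have "(1 - u) *\<^sub>R pt x y + u *\<^sub>R pt x' y' \<in> C"
    using assms by (intro convexD) auto
  also have "(1 - u) *\<^sub>R pt x y + u *\<^sub>R pt x' y' = pt X Y"
    by (simp add: pt_eq_iff assms algebra_simps)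
  finally show ?thesis .
qed

text \<open>Every point on a horizontal line through the hexagon lies between two boundary points, each of which lies on a
  side and is thus a combination of two vertices.\<close>
lemma hexagon_eq:
  assumes "1 \<le> a" "1 \<le> c"
  shows "hexagon a b c = {p. - real c \<le> xc p \<and> xc p \<le> real b \<and> 0 \<le> yc p \<and> yc p \<le> real a + real c
    \<and> 0 \<le> xc p + yc p \<and> xc p + yc p \<le> real a + real b}"
proof -
  let ?V = "{pt 0 0, pt b 0, pt b a, pt (real b - real c) (real a + real c), pt (- real c) (real a + real c), pt (- real c) c}"
  have "0 = pt 0 0" "real b *\<^sub>R e_vec = pt b 0" "real b *\<^sub>R e_vec + real a *\<^sub>R f_vec = pt b a"
    "real b *\<^sub>R e_vec + real a *\<^sub>R f_vec + real c *\<^sub>R g_vec = pt (real b - real c) (real a + real c)"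
    "real a *\<^sub>R f_vec + real c *\<^sub>R g_vec = pt (- real c) (real a + real c)"
    "real c *\<^sub>R g_vec = pt (- real c) c"
    by (simp_all add: pt_eq_iff)
  then have hull: "hexagon a b c = convex hull ?V"
    unfolding hexagon_def by metis
  define C where "C = convex hull ?V"
  have C: "convex C" by (simp add: C_def)
  have V: "pt 0 0 \<in> C" "pt b 0 \<in> C" "pt b a \<in> C" "pt (real b - real c) (real a + real c) \<in> C"
    "pt (- real c) (real a + real c) \<in> C" "pt (- real c) c \<in> C"
    unfolding C_def by (rule hull_inc; simp)+
  have "C \<subseteq> {p. - real c \<le> xc p \<and> xc p \<le> real b \<and> 0 \<le> yc p \<and> yc p \<le> real a + real c
    \<and> 0 \<le> xc p + yc p \<and> xc p + yc p \<le> real a + real b}"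
    unfolding C_def by (rule hull_minimal) (auto intro: convex_coordinate_box)
  moreover have "p \<in> C"
    if p: "- real c \<le> xc p" "xc p \<le> real b" "0 \<le> yc p" "yc p \<le> real a + real c"
      "0 \<le> xc p + yc p" "xc p + yc p \<le> real a + real b" for p
  proof -
    define y where "y = yc p"
    \<comment> \<open>the left and the right end of the hexagon at height \<open>y\<close>\<close>
    define l where "l = (if y \<le> c then - y else - real c)"
    define r where "r = (if y \<le> a then real b else real a + real b - y)"
    have y: "0 \<le> y" "y \<le> real a + real c" using p by (simp_all add: y_def)
    have l: "pt l y \<in> C"
    proof (cases "y \<le> c")
      case True
      then show ?thesis using assms y
        by (intro convex_pt_combination[OF C V(1) V(6), of "y / c"]) (auto simp: l_def)
    next
      case False
      then show ?thesis using assms y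
        by (intro convex_pt_combination[OF C V(6) V(5), of "(y - c) / a"]) (auto simp: l_def)
    qed
    have r: "pt r y \<in> C"
    proof (cases "y \<le> a")
      case True
      then show ?thesis using assms y
        by (intro convex_pt_combination[OF C V(2) V(3), of "y / a"]) (auto simp: r_def)
    next
      case False
      then show ?thesis using assms y
        by (intro convex_pt_combination[OF C V(3) V(4), of "(y - a) / c"]) (auto simp: r_def)
    qed
    have lr: "l \<le> xc p" "xc p \<le> r" using p by (auto simp: l_def r_def y_def)
    have "pt (xc p) y \<in> C"
    proof (cases "l = r")
      case True
      then show ?thesis using l lr by simp
    next
      case False
      then show ?thesis using lr
        by (intro convex_pt_combination[OF C l r, of "(xc p - l) / (r - l)"]) auto
    qed
    then show ?thesis by (simp add: y_def)
  qed
  ultimately show ?thesis unfolding hull C_def[symmetric] by blast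
qed

text \<open>A cell is the hull of its two triangles, and the box between its sides is contained in their union.\<close>
lemma corner_cell_eq:
  "corner_cell (nw_corner a c) (- f_vec) e_vec p q
    = tri (False, int q - 1 - int c, int a + int c - int p) \<union> tri (True, int q - 1 - int c, int a + int c - int p)"
proof -
  define i j where "i = int q - 1 - int c" and "j = int a + int c - int p"
  have "nw_corner a c + (real p - 1) *\<^sub>R - f_vec + (real q - 1) *\<^sub>R e_vec = pt i (j + 1)"
    "nw_corner a c + real p *\<^sub>R - f_vec + (real q - 1) *\<^sub>R e_vec = pt i j"
    "nw_corner a c + real p *\<^sub>R - f_vec + real q *\<^sub>R e_vec = pt (i + 1) j"
    "nw_corner a c + (real p - 1) *\<^sub>R - f_vec + real q *\<^sub>R e_vec = pt (i + 1) (j + 1)"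
    by (simp_all add: pt_eq_iff nw_corner_def i_def j_def)
  then have "corner_cell (nw_corner a c) (- f_vec) e_vec p q
      = convex hull {pt i (j + 1), pt i j, pt (i + 1) j, pt (i + 1) (j + 1)}"
    unfolding corner_cell_def by simp
  also have "\<dots> = tri (False, i, j) \<union> tri (True, i, j)"
  proof (rule antisym)
    let ?B = "{p. i \<le> xc p \<and> xc p \<le> i + 1 \<and> j \<le> yc p \<and> yc p \<le> j + 1
        \<and> i + j \<le> xc p + yc p \<and> xc p + yc p \<le> i + j + 2}"
    have "convex hull {pt i (j + 1), pt i j, pt (i + 1) j, pt (i + 1) (j + 1)} \<subseteq> ?B"
      by (rule hull_minimal) (auto intro: convex_coordinate_box)
    also have "?B \<subseteq> tri (False, i, j) \<union> tri (True, i, j)"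
      by (auto simp: tri_def)
    finally show "convex hull {pt i (j + 1), pt i j, pt (i + 1) j, pt (i + 1) (j + 1)}
        \<subseteq> tri (False, i, j) \<union> tri (True, i, j)" .
    show "tri (False, i, j) \<union> tri (True, i, j)
        \<subseteq> convex hull {pt i (j + 1), pt i j, pt (i + 1) j, pt (i + 1) (j + 1)}"
      unfolding tri_False_hull tri_True_hull by (intro Un_least hull_mono) auto
  qed
  finally show ?thesis unfolding i_def j_def .
qed

lemma tri_subset_hexagon:
  assumes "1 \<le> a" "1 \<le> c"
  shows "tri (u, i, j) \<subseteq> hexagon a b c \<longleftrightarrow> - int c \<le> i \<and> i + 1 \<le> int b \<and> 0 \<le> j \<and> j + 1 \<le> int a + int c
    \<and> (if u then 0 \<le> i + j \<and> i + j + 1 \<le> int a + int b else 0 \<le> i + j + 1 \<and> i + j + 2 \<le> int a + int b)"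
    (is "_ \<longleftrightarrow> ?R")
proof
  assume sub: "tri (u, i, j) \<subseteq> hexagon a b c"
  have "pt (i + 1) j \<in> tri (u, i, j)" "pt i (j + 1) \<in> tri (u, i, j)"
    "pt (if u then i else i + 1) (if u then j else j + 1) \<in> tri (u, i, j)"
    by (auto simp: tri_def)
  then have "pt (i + 1) j \<in> hexagon a b c" "pt i (j + 1) \<in> hexagon a b c"
    "pt (if u then i else i + 1) (if u then j else j + 1) \<in> hexagon a b c"
    using sub by blast+
  then show ?R
    unfolding hexagon_eq[OF assms] mem_Collect_eq xc_pt yc_pt by (auto split: if_splits)
next
  assume ?R
  then have R: "- real c \<le> of_int i" "of_int i + 1 \<le> real b" "(0::real) \<le> of_int j" "of_int j + 1 \<le> real a + real c"
    "if u then 0 \<le> real_of_int (i + j) \<and> real_of_int (i + j) + 1 \<le> real a + real b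
     else 0 \<le> real_of_int (i + j) + 1 \<and> real_of_int (i + j) + 2 \<le> real a + real b"
    by (auto split: if_splits)
  then show "tri (u, i, j) \<subseteq> hexagon a b c"
    unfolding hexagon_eq[OF assms] by (auto simp: tri_def split: if_splits)
qed

lemma tri_subset_staircase:
  assumes "a \<le> b" "- int c \<le> i" "j + 1 \<le> int a + int c"
  shows "tri (u, i, j) \<subseteq> max_staircase (nw_corner a c) (- f_vec) e_vec a b \<longleftrightarrow> i + 2 * int c + 1 \<le> j"
proof -
  let ?S = "max_staircase (nw_corner a c) (- f_vec) e_vec a b"
  define B where "B p q = tri (False, int q - 1 - int c, int a + int c - int p)
      \<union> tri (True, int q - 1 - int c, int a + int c - int p)" for p q
  have "?S = \<Union> {B p q | p q. p \<ge> 1 \<and> q \<ge> 1 \<and> p + q \<le> a}"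
    using assms(1) unfolding max_staircase_def corner_cell_eq B_def by (simp add: min_absorb1)
  then have S: "x \<in> ?S \<longleftrightarrow> (\<exists>p q. 1 \<le> p \<and> 1 \<le> q \<and> p + q \<le> a \<and> x \<in> B p q)" for x
    by auto
  show ?thesis
  proof
    assume "tri (u, i, j) \<subseteq> ?S"
    then have "center (u, i, j) \<in> ?S" by (rule subsetD[OF _ center_in_tri])
    then obtain p q where "1 \<le> p" "1 \<le> q" "p + q \<le> a" "center (u, i, j) \<in> B p q"
      unfolding S by (elim exE conjE)
    then show "i + 2 * int c + 1 \<le> j" by (auto simp: B_def center_in_tri_iff)
  next
    assume le: "i + 2 * int c + 1 \<le> j"
    \<comment> \<open>the cell whose lower left corner is \<open>(i, j)\<close>\<close>
    define p q where "p = nat (int a + int c - j)" and "q = nat (i + 1 + int c)"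
    have "tri (u, i, j) \<subseteq> B p q"
      using assms(2,3) le by (cases u) (auto simp: B_def p_def q_def)
    moreover have "1 \<le> p" "1 \<le> q" "p + q \<le> a" using assms(2,3) le by (auto simp: p_def q_def)
    ultimately have "x \<in> ?S" if "x \<in> tri (u, i, j)" for x
      unfolding S using that by (intro exI conjI) (auto dest: subsetD)
    then show "tri (u, i, j) \<subseteq> ?S" by (rule subsetI)
  qed
qed

lemma H1_eq_region:
  assumes "1 \<le> a" "1 \<le> c" "a \<le> b"
  shows "H1 a b c = region (a + b) (H1_line a b c)"
proof -
  let ?J = "H1_line a b c" and ?K = "a + b"
  let ?in = "\<lambda>t. tri t \<subseteq> hexagon a b c \<and> \<not> tri t \<subseteq> max_staircase (nw_corner a c) (- f_vec) e_vec a b"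
  have in_iff: "?in (u, i, j) \<longleftrightarrow> - int c \<le> i \<and> i + 1 \<le> int b \<and> 0 \<le> j \<and> j + 1 \<le> int a + int c
    \<and> (if u then 0 \<le> i + j \<and> i + j + 1 \<le> int a + int b else 0 \<le> i + j + 1 \<and> i + j + 2 \<le> int a + int b)
    \<and> j < i + 2 * int c + 1" for u i j
    using tri_subset_hexagon[OF assms(1,2), of u i j b] tri_subset_staircase[OF assms(3), of c i j u]
    by (auto split: if_splits)
  have down: "?in (False, i, j) \<longleftrightarrow> (\<exists>d\<in>Sigma {..<?K} ?J. (i, j) = (int (fst d) - 1 - int (snd d), int (snd d)))" for i j
  proof
    assume "?in (False, i, j)"
    then have "(nat (i + j + 1), nat j) \<in> Sigma {..<?K} ?J"
      "(i, j) = (int (nat (i + j + 1)) - 1 - int (nat j), int (nat j))"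
      unfolding in_iff by (auto simp: H1_line_def nat_le_eq_zle nat_less_iff)
    then show "\<exists>d\<in>Sigma {..<?K} ?J. (i, j) = (int (fst d) - 1 - int (snd d), int (snd d))"
      by (metis fst_conv snd_conv)
  next
    assume "\<exists>d\<in>Sigma {..<?K} ?J. (i, j) = (int (fst d) - 1 - int (snd d), int (snd d))"
    then show "?in (False, i, j)" unfolding in_iff by (auto simp: H1_line_def)
  qed
  have up: "?in (True, i, j) \<longleftrightarrow> (\<exists>d\<in>Sigma {1..?K} ?J. (i, j) = (int (fst d) - 1 - int (snd d), int (snd d)))" for i j
  proof
    assume "?in (True, i, j)"
    then have "(nat (i + j + 1), nat j) \<in> Sigma {1..?K} ?J"
      "(i, j) = (int (nat (i + j + 1)) - 1 - int (nat j), int (nat j))"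
      unfolding in_iff by (auto simp: H1_line_def nat_le_eq_zle nat_less_iff)
    then show "\<exists>d\<in>Sigma {1..?K} ?J. (i, j) = (int (fst d) - 1 - int (snd d), int (snd d))"
      by (metis fst_conv snd_conv)
  next
    assume "\<exists>d\<in>Sigma {1..?K} ?J. (i, j) = (int (fst d) - 1 - int (snd d), int (snd d))"
    then show "?in (True, i, j)" unfolding in_iff by (auto simp: H1_line_def)
  qed
  have union_reindex: "\<Union> {T. (\<exists>t. T = f t) \<and> Q T} = (\<Union>t\<in>{t. Q (f t)}. f t)"
    for f :: "bool \<times> int \<times> int \<Rightarrow> (real \<times> real) set" and Q
    by blast
  have union_split: "(\<Union>t\<in>{t. Q t}. f t) = (\<Union>s\<in>{s. Q (False, s)}. f (False, s)) \<union> (\<Union>s\<in>{s. Q (True, s)}. f (True, s))"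
    for f :: "bool \<times> int \<times> int \<Rightarrow> (real \<times> real) set" and Q
  proof -
    have "(\<exists>t. R t) \<longleftrightarrow> (\<exists>s. R (False, s)) \<or> (\<exists>s. R (True, s))" for R :: "bool \<times> int \<times> int \<Rightarrow> bool"
      by (metis (full_types) surj_pair)
    then show ?thesis by (simp only: set_eq_iff UN_iff Un_iff mem_Collect_eq Bex_def) simp
  qed
  have "H1 a b c = (\<Union>t\<in>{t. ?in t}. tri t)"
    unfolding H1_def remove_region_def unit_triangle_iff by (rule union_reindex)
  also have "\<dots> = (\<Union>s\<in>{s. ?in (False, s)}. tri (False, s)) \<union> (\<Union>s\<in>{s. ?in (True, s)}. tri (True, s))"
    by (rule union_split)
  also have "{s. ?in (False, s)} = (\<lambda>d. (int (fst d) - 1 - int (snd d), int (snd d))) ` Sigma {..<?K} ?J"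
  proof (rule Set.set_eqI)
    fix s :: "int \<times> int"
    obtain i j where "s = (i, j)" by (cases s)
    then show "s \<in> {s. ?in (False, s)} \<longleftrightarrow> s \<in> (\<lambda>d. (int (fst d) - 1 - int (snd d), int (snd d))) ` Sigma {..<?K} ?J"
      using down[of i j] by (simp only: mem_Collect_eq image_iff)
  qed
  also have "{s. ?in (True, s)} = (\<lambda>d. (int (fst d) - 1 - int (snd d), int (snd d))) ` Sigma {1..?K} ?J"
  proof (rule Set.set_eqI)
    fix s :: "int \<times> int"
    obtain i j where "s = (i, j)" by (cases s)
    then show "s \<in> {s. ?in (True, s)} \<longleftrightarrow> s \<in> (\<lambda>d. (int (fst d) - 1 - int (snd d), int (snd d))) ` Sigma {1..?K} ?J"
      using up[of i j] by (simp only: mem_Collect_eq image_iff)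
  qed
  finally show ?thesis
    unfolding region_def down_at_def up_at_def by (simp add: case_prod_unfold image_image)
qed

lemma nw_marked_eq:
  assumes "a \<le> b"
  shows "nw_marked a b c = (\<lambda>m. down_at (2 * m + 1, c + m) \<union> up_at (2 * m + 1, c + m)) ` {..<a}"
proof -
  have "nw_marked a b c = {corner_cell (nw_corner a c) (- f_vec) e_vec p q | p q. p \<ge> 1 \<and> q \<ge> 1 \<and> p + q = a + 1}"
    using assms by (simp add: nw_marked_def marked_positions_def min_absorb1)
  also have "\<dots> = (\<lambda>m. corner_cell (nw_corner a c) (- f_vec) e_vec (a - m) (Suc m)) ` {..<a}"
  proof (intro equalityI subsetI)
    fix L assume "L \<in> {corner_cell (nw_corner a c) (- f_vec) e_vec p q | p q. p \<ge> 1 \<and> q \<ge> 1 \<and> p + q = a + 1}"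
    then obtain p q where "L = corner_cell (nw_corner a c) (- f_vec) e_vec p q" "1 \<le> p" "1 \<le> q" "p + q = a + 1"
      by blast
    moreover from this have "a - (q - 1) = p" "Suc (q - 1) = q" "q - 1 \<in> {..<a}" by auto
    ultimately show "L \<in> (\<lambda>m. corner_cell (nw_corner a c) (- f_vec) e_vec (a - m) (Suc m)) ` {..<a}"
      by (intro image_eqI[of _ _ "q - 1"]) simp_all
  next
    fix L assume "L \<in> (\<lambda>m. corner_cell (nw_corner a c) (- f_vec) e_vec (a - m) (Suc m)) ` {..<a}"
    then obtain m where "m < a" "L = corner_cell (nw_corner a c) (- f_vec) e_vec (a - m) (Suc m)" by auto
    then show "L \<in> {corner_cell (nw_corner a c) (- f_vec) e_vec p q | p q. p \<ge> 1 \<and> q \<ge> 1 \<and> p + q = a + 1}"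
      by (intro CollectI exI[of _ "a - m"] exI[of _ "Suc m"]) auto
  qed
  also have "\<dots> = (\<lambda>m. down_at (2 * m + 1, c + m) \<union> up_at (2 * m + 1, c + m)) ` {..<a}"
    unfolding corner_cell_eq
    by (intro image_cong refl) (simp add: down_at_def up_at_def of_nat_diff algebra_simps)
  finally show ?thesis .
qed

text \<open>The rhombus around edge \<open>(k, j)\<close> belongs to the tiling exactly if the matching fixes \<open>(k, j)\<close>.\<close>
lemma marked_weight:
  assumes "a \<le> b"
  shows "1 / 2 ^ card (tiling_of (a + b) (H1_line a b c) \<sigma> \<inter> nw_marked a b c)
    = (\<Prod>m<a. if \<sigma> (2 * m + 1, c + m) = (2 * m + 1, c + m) then 1 / 2 else 1 :: real)"
proof -
  let ?cell = "\<lambda>m. down_at (2 * m + 1, c + m) \<union> up_at (2 * m + 1, c + m)"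
  let ?M = "{m \<in> {..<a}. \<sigma> (2 * m + 1, c + m) = (2 * m + 1, c + m)}"
  have "?cell m \<in> tiling_of (a + b) (H1_line a b c) \<sigma> \<longleftrightarrow> \<sigma> (2 * m + 1, c + m) = (2 * m + 1, c + m)"
    if "m < a" for m
  proof -
    have d: "(2 * m + 1, c + m) \<in> Sigma {..<a + b} (H1_line a b c)"
      using that assms by (auto simp: H1_line_def)
    have "?cell m \<in> tiling_of (a + b) (H1_line a b c) \<sigma>
        \<longleftrightarrow> (\<exists>d\<in>Sigma {..<a + b} (H1_line a b c). (2 * m + 1, c + m) = d \<and> (2 * m + 1, c + m) = \<sigma> d)"
      unfolding tiling_of_def image_iff down_up_union_eq_iff ..
    then show ?thesis using d by metis
  qed
  then have "tiling_of (a + b) (H1_line a b c) \<sigma> \<inter> nw_marked a b c = ?cell ` ?M"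
    unfolding nw_marked_eq[OF assms] by auto
  moreover have "inj_on ?cell ?M"
    by (rule inj_onI) (simp only: down_up_union_eq_iff prod.inject add_left_cancel)
  ultimately have "card (tiling_of (a + b) (H1_line a b c) \<sigma> \<inter> nw_marked a b c) = card ?M"
    by (simp only: card_image)
  moreover have "(\<Prod>m<a. if \<sigma> (2 * m + 1, c + m) = (2 * m + 1, c + m) then 1 / 2 else 1 :: real)
      = (\<Prod>m\<in>?M. 1 / 2)"
    by (rule prod.inter_filter[symmetric]) simp
  ultimately show ?thesis by (simp add: power_one_over)
qed

theorem theorem1p4:
  fixes a b c :: nat
  assumes "a \<ge> 1" and "b \<ge> 1" and "c \<ge> 1" and "a \<le> b"
  shows "Lstar_H1 a b c =
    1 / 2 ^ a *
    (\<Prod>i = 1..a.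
       (\<Prod>j = 1..b - a. (real c + real i + real j - 1) / (real i + real j - 1)) *
       (\<Prod>j = b - a + i..b. (2 * real c + real i + real j - 1) / (real i + real j - 1)))"
proof -
  let ?K = "a + b" and ?J = "H1_line a b c"
  have "Lstar_H1 a b c = (\<Sum>\<T>\<in>{\<T>. lozenge_tiling (region ?K ?J) \<T>}. 1 / 2 ^ card (\<T> \<inter> nw_marked a b c))"
    unfolding Lstar_H1_def H1_eq_region[OF assms(1,3,4)] ..
  also have "\<dots> = (\<Sum>\<sigma>\<in>matchings ?K ?J. 1 / 2 ^ card (tiling_of ?K ?J \<sigma> \<inter> nw_marked a b c))"
    by (rule sum.reindex_bij_betw[OF bij_betw_matchings_tilings, symmetric])
  also have "\<dots> = 2 ^ (?K div 2 - a) * weighted_count c ?K {a..<a + c}"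
    unfolding marked_weight[OF assms(4)] by (rule sum_matchings_H1_line[OF assms(4)])
  finally show ?thesis
    unfolding weighted_count_final[OF assms(4)] target_eq_row_product[OF assms(4)] .
qed

end
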